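(* Let $\ell$ be an odd prime, $n$ a positive integer and $t$ an integer, and let $\Phi(x)=T_\ell^n(x)-t$. Suppose $\Phi$ is irreducible over $\mathbb{Q}$, let $\theta$ be a root of $\Phi$ and $K=\mathbb{Q}(\theta)$. Then $D(\Phi)=\Delta(K)$ if and only if (1) $\Phi(t)\not\equiv 0\pmod{\ell^2}$, and (2) both $t-2$ and $t+2$ are square-free.
   Context: $T_d(x)$ is the Chebyshev polynomial of the first kind of degree $d$ (the unique monic polynomial with $T_d(z+z^{-1})=z^d+z^{-d}$; it has integer coefficients), and $T_\ell^n$ denotes the $n$-fold composition of $T_\ell$. $D(\Phi)=\prod_{i<j}(\theta_j-\theta_i)^2$ is the discriminant of the polynomial $\Phi$ (with roots $\theta_1,\dots,\theta_{\ell^n}$), and $\Delta(K)$ is the discriminant of the number field $K$ (the discriminant of a $\mathbb{Z}$-basis of its ring of integers). *)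

theory Defs
  imports
    Complex_Main
    "HOL-Library.FuncSet"
    "HOL-Computational_Algebra.Computational_Algebra"
    "HOL-Number_Theory.Cong"
    "Jordan_Normal_Form.Determinant"
begin

text \<open>
  The normalisation is \<open>T\<^sub>d(z + 1/z) = z\<^sup>d + 1/z\<^sup>d\<close>, i.e. \<open>T\<^sub>d(2 cos \<phi>) = 2 cos (d \<phi>)\<close>;
  see \<open>chebyshev_T_characterization\<close> below.
\<close>

fun chebyshev_T :: "nat \<Rightarrow> int poly" where
  "chebyshev_T 0 = [:2:]"
| "chebyshev_T (Suc 0) = [:0, 1:]"
| "chebyshev_T (Suc (Suc d)) = [:0, 1:] * chebyshev_T (Suc d) - chebyshev_T d"

definition chebyshev_T_iter :: "nat \<Rightarrow> nat \<Rightarrow> int poly" where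
  "chebyshev_T_iter l n = ((\<lambda>p. pcompose (chebyshev_T l) p) ^^ n) [:0, 1:]"

lemma chebyshev_T_degree_monic:
  "d > 0 \<Longrightarrow> degree (chebyshev_T d) = d \<and> lead_coeff (chebyshev_T d) = 1"
proof (induction d rule: chebyshev_T.induct)
  case (3 d)
  let ?p = "[:0, 1:] * chebyshev_T (Suc d)" and ?q = "chebyshev_T d"
  have IH: "degree (chebyshev_T (Suc d)) = Suc d" "lead_coeff (chebyshev_T (Suc d)) = 1"
    using 3 by auto
  have ne: "chebyshev_T (Suc d) \<noteq> 0" using IH by auto
  have dp: "degree ?p = Suc (Suc d)" using IH ne by (subst degree_mult_eq) auto
  have lp: "lead_coeff ?p = 1" using IH by (simp only: lead_coeff_mult) simp
  have dq: "degree ?q \<le> d" using 3 by (cases d) auto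
  have deg: "degree (?p - ?q) = Suc (Suc d)"
    using dp dq degree_add_eq_left[of "- ?q" ?p] by simp
  moreover have "coeff ?q (Suc (Suc d)) = 0" using dq by (intro coeff_eq_0) auto
  moreover have "coeff ?p (Suc (Suc d)) = 1" using lp dp by simp
  ultimately have "degree (chebyshev_T (Suc (Suc d))) = Suc (Suc d)"
    "coeff (chebyshev_T (Suc (Suc d))) (Suc (Suc d)) = 1"
    unfolding chebyshev_T.simps coeff_diff by (simp_all only: diff_zero)
  then show ?case by simp
qed auto

lemma chebyshev_T_identity:
  fixes z :: complex
  assumes "z \<noteq> 0"
  shows "poly (map_poly of_int (chebyshev_T d)) (z + inverse z) = z ^ d + inverse z ^ d"
proof (induction d rule: chebyshev_T.induct)
  case (3 d)
  have step: "map_poly of_int ([:0, 1:] * p - q) =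
      [:0, 1:] * map_poly of_int p - (map_poly of_int q :: complex poly)" for p q :: "int poly"
    by (rule poly_eqI) (simp add: coeff_map_poly coeff_pCons split: nat.splits)
  show ?case
    unfolding chebyshev_T.simps step poly_diff poly_mult 3
    using assms by (simp add: field_simps)
qed (auto simp: map_poly_pCons)

lemma complex_eq_plus_inverse: "\<exists>z::complex. z \<noteq> 0 \<and> w = z + inverse z"
proof -
  define s where "s = csqrt (w^2 - 4)"
  have s: "s ^ 2 = w ^ 2 - 4" by (simp add: s_def)
  define z where "z = (w + s) / 2"
  have q: "z * (w - z) = 1" using s by (simp add: z_def field_simps power2_eq_square)
  then have "z \<noteq> 0" by auto
  moreover from q this have "inverse z = w - z" by (metis inverse_unique)
  ultimately show ?thesis by (intro exI[of _ z]) auto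
qed

theorem chebyshev_T_characterization:
  assumes "d > 0"
  shows "p = chebyshev_T d \<longleftrightarrow> lead_coeff p = 1 \<and>
    (\<forall>z::complex. z \<noteq> 0 \<longrightarrow> poly (map_poly of_int p) (z + inverse z) = z ^ d + inverse z ^ d)"
    (is "_ \<longleftrightarrow> ?R")
proof
  assume "p = chebyshev_T d"
  then show ?R using chebyshev_T_degree_monic[OF assms] chebyshev_T_identity by metis
next
  assume R: ?R
  have "poly (map_poly of_int p) w = poly (map_poly of_int (chebyshev_T d)) w" for w :: complex
    using complex_eq_plus_inverse[of w] R chebyshev_T_identity by auto
  then have eq: "map_poly of_int p = (map_poly of_int (chebyshev_T d) :: complex poly)"
    using poly_eq_poly_eq_iff by blast
  show "p = chebyshev_T d"
  proof (rule poly_eqI)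
    fix n show "coeff p n = coeff (chebyshev_T d) n"
      using arg_cong[OF eq, of "\<lambda>q. coeff q n"] by (simp add: coeff_map_poly)
  qed
qed

text \<open>
  The discriminant of a monic polynomial. The roots are listed with multiplicity in an
  arbitrary order, on which the product does not depend.
\<close>

definition poly_discriminant :: "complex poly \<Rightarrow> complex" where
  "poly_discriminant p =
     (let \<theta> = (SOME xs. mset xs = proots p)
      in \<Prod>(i, j) \<in> {(i, j). i < j \<and> j < length \<theta>}. (\<theta> ! j - \<theta> ! i)\<^sup>2)"

text \<open>Number fields are subfields of the complex numbers.\<close>

definition complex_subfield :: "complex set \<Rightarrow> bool" where
  "complex_subfield K \<longleftrightarrow> 0 \<in> K \<and> 1 \<in> K \<and>
     (\<forall>x\<in>K. \<forall>y\<in>K. x + y \<in> K \<and> x * y \<in> K) \<and> (\<forall>x\<in>K. - x \<in> K \<and> inverse x \<in> K)"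

text \<open>The field \<open>\<rat>(\<theta>)\<close>: every subfield of the complex numbers contains the rationals.\<close>

definition rat_adjoin :: "complex \<Rightarrow> complex set" where
  "rat_adjoin \<theta> = \<Inter>{K. complex_subfield K \<and> \<theta> \<in> K}"

definition ring_of_integers :: "complex set \<Rightarrow> complex set" where
  "ring_of_integers K = {x \<in> K. algebraic_int x}"

definition integral_basis :: "complex set \<Rightarrow> complex list \<Rightarrow> bool" where
  "integral_basis K bs \<longleftrightarrow> set bs \<subseteq> ring_of_integers K \<and>
     (\<forall>x \<in> ring_of_integers K. \<exists>!cs :: int list.
        length cs = length bs \<and> x = (\<Sum>i<length bs. of_int (cs ! i) * bs ! i))"

text \<open>
  The field embeddings of \<open>K\<close> into the complex numbers; extensionality makes each of them
  correspond to exactly one HOL function.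
\<close>

definition field_embeddings :: "complex set \<Rightarrow> (complex \<Rightarrow> complex) set" where
  "field_embeddings K = {\<sigma> \<in> extensional K. \<sigma> 1 = 1 \<and>
     (\<forall>x\<in>K. \<forall>y\<in>K. \<sigma> (x + y) = \<sigma> x + \<sigma> y \<and> \<sigma> (x * y) = \<sigma> x * \<sigma> y)}"

definition field_trace :: "complex set \<Rightarrow> complex \<Rightarrow> complex" where
  "field_trace K x = (\<Sum>\<sigma>\<in>field_embeddings K. \<sigma> x)"

definition basis_discriminant :: "complex set \<Rightarrow> complex list \<Rightarrow> complex" where
  "basis_discriminant K bs =
     det (mat (length bs) (length bs) (\<lambda>(i, j). field_trace K (bs ! i * bs ! j)))"

text \<open>The discriminant does not depend on the choice of the integral basis.\<close>

definition field_discriminant :: "complex set \<Rightarrow> complex" where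
  "field_discriminant K = basis_discriminant K (SOME bs. integral_basis K bs)"

end

theory Submission
  imports
    Defs
    "Jordan_Normal_Form.Char_Poly"
    "HOL-Computational_Algebra.Field_as_Ring"
    "HOL-Number_Theory.Residues"
begin

text \<open>
  Write \<open>N = \<ell>\<^sup>n = 2m + 1\<close>, so that \<open>\<Phi> = T\<^sub>N - t\<close>. For an integral basis whose coordinates with
  respect to the powers of \<open>\<theta>\<close> form the matrix \<open>C\<close> one has \<open>\<Delta>(K) = D(\<Phi>) det(C)\<^sup>2\<close>, so
  \<open>D(\<Phi>) = \<Delta>(K)\<close> means that \<open>\<int>[\<theta>]\<close> is the full ring of integers. As
  \<open>D(\<Phi>)\<^sup>2 = N\<^sup>2\<^sup>N (t\<^sup>2 - 4)\<^sup>N\<^sup>-\<^sup>1\<close>, only \<open>\<ell>\<close> and the prime divisors of \<open>t - 2\<close> and \<open>t + 2\<close> matter.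

  There are polynomials \<open>G\<close> and \<open>H\<close> with \<open>T\<^sub>N - 2 = (X - 2) G\<^sup>2\<close> and \<open>T\<^sub>N + 2 = (X + 2) H\<^sup>2\<close>, so
  \<open>(\<theta> - 2) G(\<theta>)\<^sup>2 = t - 2\<close>. If \<open>y\<^sup>2\<close> divides \<open>t - 2\<close>, then \<open>(\<theta> - 2) G(\<theta>) / y\<close> is integral. If a
  prime \<open>p \<noteq> \<ell>\<close> divides \<open>t - 2\<close> exactly once, then \<open>(\<theta> - 2) G(\<theta>)\<close> generates the radical of
  \<open>\<int>[\<theta>]\<close> locally at \<open>p\<close>, which makes \<open>\<int>[\<theta>]\<close> maximal at \<open>p\<close>. The same applies to \<open>t + 2\<close>. At
  \<open>\<ell>\<close> one has \<open>\<Phi> \<equiv> (X - t)\<^sup>N\<close>, and with \<open>\<Phi> = (X - t) q + \<Phi>(t)\<close> the roles are played by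
  \<open>\<theta> - t\<close> and \<open>q(\<theta>) / \<ell>\<close>.
\<close>

section \<open>Algebraic integers\<close>

hide_const (open) up_ring.monom up_ring.coeff module.smult

text \<open>Localisation at a prime is replaced by clearing denominators: elements of
  \<open>\<int>[\<theta>]\<close> are values of integer polynomials, ideals
  \<open>(f(\<theta>), p)\<close> become congruences between polynomials, and units at
  \<open>p\<close> become integers prime to \<open>p\<close>. The delicate point is that
  \<open>\<int>[\<theta>]/(f(\<theta>), p)\<close> is reduced. For \<open>f = (X - 2) G\<close> this
  rests on the roots \<open>\<zeta> + 1/\<zeta>\<close> of \<open>f\<close> with
  \<open>\<zeta>^N = 1\<close>. For \<open>f = (X + 2) H\<close> one has
  \<open>\<zeta>^N = -1\<close>, and the period \<open>2N\<close> forces \<open>p\<close> to be odd.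
  The prime \<open>2\<close> is covered nevertheless, since it divides both or neither of
  \<open>t - 2\<close> and \<open>t + 2\<close>. The prime \<open>\<ell>\<close> may divide
  \<open>t - 2\<close> or \<open>t + 2\<close> as well, but it divides \<open>N\<close>, and
  maximality there is decided by \<open>\<Phi>(t)\<close> alone.

  The discriminant enters as \<open>D(\<Phi>)\<^sup>2\<close> because this is the product of the
  squares of \<open>\<Phi>'\<close> at the roots, with no sign to determine.\<close>

definition ev :: "int poly \<Rightarrow> complex \<Rightarrow> complex" where
  "ev p x = poly (map_poly of_int p) x"

lemma ev_0 [simp]: "ev 0 x = 0"
  and ev_1 [simp]: "ev 1 x = 1"
  and ev_add [simp]: "ev (p + q) x = ev p x + ev q x"
  and ev_diff [simp]: "ev (p - q) x = ev p x - ev q x"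
  and ev_uminus [simp]: "ev (- p) x = - ev p x"
  and ev_mult [simp]: "ev (p * q) x = ev p x * ev q x"
  and ev_power [simp]: "ev (p ^ n) x = ev p x ^ n"
  and ev_pCons [simp]: "ev (pCons a p) x = of_int a + x * ev p x"
  and ev_smult [simp]: "ev (smult a p) x = of_int a * ev p x"
  and ev_monom [simp]: "ev (monom a n) x = of_int a * x ^ n"
  by (simp_all add: ev_def of_int_poly_hom.hom_add of_int_poly_hom.hom_minus of_int_poly_hom.hom_uminus
    of_int_poly_hom.hom_mult of_int_poly_hom.hom_power of_int_hom.map_poly_pCons_hom
     of_int_hom.map_poly_hom_smult poly_monom)

lemma ev_sum [simp]: "ev (sum f A) x = (\<Sum>i\<in>A. ev (f i) x)"
  by (induction A rule: infinite_finite_induct) auto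

lemma ev_of_int [simp]: "ev (of_int k) x = of_int k"
  by (simp add: of_int_poly)

lemma ev_pcompose [simp]: "ev (pcompose p q) x = ev p (ev q x)"
  by (induction p) simp_all

lemma ev_altdef: "degree p < n \<Longrightarrow> ev p x = (\<Sum>i<n. of_int (coeff p i) * x ^ i)"
proof -
  assume "degree p < n"
  then have "(\<Sum>i<n. monom (coeff p i) i) = p"
    by (intro poly_eqI) (auto simp: coeff_sum  coeff_eq_0)
  then have "ev p x = ev (\<Sum>i<n. monom (coeff p i) i) x" by simp
  then show ?thesis by simp
qed

lemma algebraic_int_iff_ev: "algebraic_int x \<longleftrightarrow> (\<exists>p. lead_coeff p = 1 \<and> ev p x = 0)"
  by (auto simp: algebraic_int_altdef_ipoly ev_def)

interpretation int_module: Modules.module "\<lambda>(k::int) (x::complex). of_int k * x"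
  by standard (simp_all add: algebra_simps)

text \<open>The determinant trick: multiplication by \<open>x\<close> on the generators is given by
  an integer matrix, which has the vector of generators as eigenvector for \<open>x\<close>, so
  \<open>x\<close> is a root of a monic integer characteristic polynomial.\<close>

lemma algebraic_int_if_stable_span:
  assumes fin: "finite S" and s0: "s0 \<in> S" "s0 \<noteq> 0"
    and stab: "\<And>s. s \<in> S \<Longrightarrow> x * s \<in> int_module.span S"
  shows "algebraic_int x"
proof -
  obtain xs where xs: "set xs = S" "distinct xs"
    using finite_distinct_list[OF fin] by blast
  define n where "n = length xs"
  have "\<forall>s\<in>S. \<exists>u. x * s = (\<Sum>v\<in>S. of_int (u v) * v)"
    using stab unfolding int_module.span_finite[OF fin] by auto
  then obtain u where u: "x * s = (\<Sum>v\<in>S. of_int (u s v) * v)" if "s \<in> S" for s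
    by metis
  define M where "M = mat n n (\<lambda>(i, j). u (xs ! i) (xs ! j))"
  define M' :: "complex mat" where "M' = map_mat of_int M"
  define v where "v = vec n (\<lambda>i. xs ! i)"
  have M: "M \<in> carrier_mat n n" "M' \<in> carrier_mat n n" by (auto simp: M_def M'_def)
  have "M' *\<^sub>v v = x \<cdot>\<^sub>v v"
  proof (rule eq_vecI)
    fix i assume "i < dim_vec (x \<cdot>\<^sub>v v)"
    then have i: "i < n" by (simp add: v_def)
    then have "xs ! i \<in> S" using xs by (auto simp: n_def)
    have "(M' *\<^sub>v v) $ i = (\<Sum>j<n. of_int (u (xs ! i) (xs ! j)) * xs ! j)"
      using i by (simp add: M'_def M_def v_def scalar_prod_def atLeast0LessThan)
    also have "\<dots> = (\<Sum>v\<in>S. of_int (u (xs ! i) v) * v)"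
      by (rule sum.reindex_bij_betw) (use bij_betw_nth[OF xs(2)] xs n_def in auto)
    also have "\<dots> = x * xs ! i" using u[OF \<open>xs ! i \<in> S\<close>] by simp
    finally show "(M' *\<^sub>v v) $ i = (x \<cdot>\<^sub>v v) $ i" using i by (simp add: v_def)
  qed (auto simp: M'_def M_def v_def)
  moreover have "v \<noteq> 0\<^sub>v n"
  proof -
    obtain i where "i < n" "xs ! i = s0" using s0 xs by (auto simp: in_set_conv_nth n_def)
    then show ?thesis using s0(2) by (auto simp: v_def vec_eq_iff)
  qed
  ultimately have "eigenvalue M' x"
    unfolding eigenvalue_def eigenvector_def using M by (intro exI[of _ v]) (auto simp: v_def)
  then have "poly (char_poly M') x = 0" using eigenvalue_root_char_poly[OF M(2)] by simp
  then have "ev (char_poly M) x = 0"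
    unfolding M'_def of_int_hom.char_poly_hom[OF M(1)] by (simp add: ev_def)
  moreover have "lead_coeff (char_poly M) = 1" using degree_monic_char_poly[OF M(1)] by auto
  ultimately show ?thesis unfolding algebraic_int_iff_ev by blast
qed

text \<open>The multiplier ring of the module spanned by \<open>S\<close>. For finite
  \<open>S\<close> with a nonzero element it consists of algebraic integers, which makes it a
  convenient ring to contain two given ones.\<close>

definition multipliers :: "complex set \<Rightarrow> complex set" where
  "multipliers S = {x. \<forall>u\<in>int_module.span S. x * u \<in> int_module.span S}"

lemma multipliersI:
  assumes "\<And>s. s \<in> S \<Longrightarrow> x * s \<in> int_module.span S"
  shows "x \<in> multipliers S"
proof -
  have "x * u \<in> int_module.span S" if "u \<in> int_module.span S" for u
    using that
  proof (induction rule: int_module.span_induct_alt)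
    case base
    then show ?case by (simp add: int_module.span_zero)
  next
    case (step c s y)
    have "of_int c * (x * s) + x * y \<in> int_module.span S"
      by (intro int_module.span_add int_module.span_scale assms step)
    then show ?case by (simp add: algebra_simps)
  qed
  then show ?thesis by (auto simp: multipliers_def)
qed

lemma multipliers_add: "x \<in> multipliers S \<Longrightarrow> y \<in> multipliers S \<Longrightarrow> x + y \<in> multipliers S"
  by (auto simp: multipliers_def distrib_right intro: int_module.span_add)

lemma multipliers_mult: "x \<in> multipliers S \<Longrightarrow> y \<in> multipliers S \<Longrightarrow> x * y \<in> multipliers S"
  by (auto simp: multipliers_def mult.assoc)

lemma multipliers_of_int: "of_int k \<in> multipliers S"
  by (auto simp: multipliers_def intro: int_module.span_scale)

lemma multipliers_ev: "x \<in> multipliers S \<Longrightarrow> ev p x \<in> multipliers S"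
  by (induction p) (use multipliers_of_int[of 0] in \<open>auto intro: multipliers_add multipliers_mult multipliers_of_int\<close>)

lemma monic_root_power_eq:
  assumes "lead_coeff p = 1"
    and "ev p x = 0"
  shows "x ^ degree p = (\<Sum>i<degree p. of_int (- coeff p i) * x ^ i)"
proof -
  have "ev p x = (\<Sum>i<Suc (degree p). of_int (coeff p i) * x ^ i)" by (rule ev_altdef) simp
  then show ?thesis using assms by (simp add: sum_negf eq_neg_iff_add_eq_0 add.commute)
qed

text \<open>The finitely generated group spanned by the \<open>x\<^sup>i y\<^sup>j\<close> with \<open>i < m\<close> and \<open>j < n\<close> is a ring.\<close>

lemma integral_extension:
  assumes x: "algebraic_int x"
    and y: "y ^ n = (\<Sum>j<n. ev (q j) x * y ^ j)" and n: "n > 0"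
  obtains R where "\<And>z. z \<in> R \<Longrightarrow> algebraic_int z" "x \<in> R" "y \<in> R"
    "\<And>u v. u \<in> R \<Longrightarrow> v \<in> R \<Longrightarrow> u + v \<in> R" "\<And>u v. u \<in> R \<Longrightarrow> v \<in> R \<Longrightarrow> u * v \<in> R"
proof -
  obtain p where p: "lead_coeff p = 1" "ev p x = 0" using x algebraic_int_iff_ev by auto
  define m where "m = degree p"
  have xm: "x ^ m = (\<Sum>i<m. of_int (- coeff p i) * x ^ i)"
    using monic_root_power_eq[OF p] by (simp add: m_def)
  have m: "m > 0" using xm by (cases m) auto
  define S where "S = (\<lambda>(i, j). x ^ i * y ^ j) ` ({..<m} \<times> {..<n})"
  have fin: "finite S" by (simp add: S_def)
  have inS: "x ^ i * y ^ j \<in> int_module.span S" if "i < m" "j < n" for i j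
    using that by (intro int_module.span_base) (auto simp: S_def)
  have xR: "x \<in> multipliers S"
  proof (rule multipliersI)
    fix s assume "s \<in> S"
    then obtain i j where s: "s = x ^ i * y ^ j" and ij: "i < m" "j < n" by (auto simp: S_def)
    show "x * s \<in> int_module.span S"
    proof (cases "Suc i < m")
      case True
      then show ?thesis using inS[of "Suc i" j] ij by (simp add: s mult.assoc)
    next
      case False
      then have "Suc i = m" using ij by simp
      then have "x * s = x ^ m * y ^ j" unfolding s by (metis mult.assoc power_Suc)
      also have "\<dots> = (\<Sum>k<m. of_int (- coeff p k) * (x ^ k * y ^ j))"
        unfolding xm sum_distrib_right mult.assoc ..
      also have "\<dots> \<in> int_module.span S"
        by (intro int_module.span_sum int_module.span_scale inS) (use ij in auto)
      finally show ?thesis .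
    qed
  qed
  have yR: "y \<in> multipliers S"
  proof (rule multipliersI)
    fix s assume "s \<in> S"
    then obtain i j where s: "s = x ^ i * y ^ j" and ij: "i < m" "j < n" by (auto simp: S_def)
    show "y * s \<in> int_module.span S"
    proof (cases "Suc j < n")
      case True
      then show ?thesis using inS[of i "Suc j"] ij by (simp add: s mult_ac)
    next
      case False
      then have "Suc j = n" using ij by simp
      then have "y * s = x ^ i * y ^ n" unfolding s by (metis mult.left_commute power_Suc)
      also have "\<dots> = (\<Sum>k<n. ev (q k) x * (x ^ i * y ^ k))"
        unfolding y sum_distrib_left by (simp add: mult.left_commute)
      also have "\<dots> \<in> int_module.span S"
        by (intro int_module.span_sum) (use inS[of i] ij multipliers_ev[OF xR] in \<open>auto simp: multipliers_def\<close>)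
      finally show ?thesis .
    qed
  qed
  show thesis
  proof (rule that[of "multipliers S"])
    fix z assume "z \<in> multipliers S"
    moreover have "1 \<in> S" unfolding S_def using m n by (intro image_eqI[of _ _ "(0, 0)"]) auto
    ultimately show "algebraic_int z"
      by (intro algebraic_int_if_stable_span[OF fin, of 1])
        (auto simp: multipliers_def intro: int_module.span_base)
  qed (use xR yR in \<open>auto intro: multipliers_add multipliers_mult\<close>)
qed

lemma algebraic_int_add_mult:
  assumes x: "algebraic_int x" and y: "algebraic_int (y :: complex)"
  shows algebraic_int_add: "algebraic_int (x + y)" and algebraic_int_mult: "algebraic_int (x * y)"
proof -
  obtain p where p: "lead_coeff p = 1" "ev p y = 0" using y algebraic_int_iff_ev by auto
  have yn: "y ^ degree p = (\<Sum>j<degree p. ev [:- coeff p j:] x * y ^ j)"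
    using monic_root_power_eq[OF p] by simp
  then have "degree p > 0" by (cases "degree p") auto
  then show "algebraic_int (x + y)" "algebraic_int (x * y)"
    by (rule integral_extension[OF x yn], simp)+
qed

text \<open>Serves the elements that show \<open>\<int>[\<theta>]\<close> to be too small: each is a
  root of a monic quadratic over \<open>\<int>[\<theta>]\<close>.\<close>

lemma algebraic_int_quadratic:
  assumes x: "algebraic_int x" and y: "y\<^sup>2 = ev r x * y + ev c x"
  shows "algebraic_int y"
proof -
  have "y ^ 2 = (\<Sum>j<2. ev (if j = 0 then c else r) x * y ^ j)"
    using y by (simp add: numeral_2_eq_2)
  then show ?thesis by (rule integral_extension[OF x]) auto
qed

lemma algebraic_int_diff: "algebraic_int x \<Longrightarrow> algebraic_int (y :: complex) \<Longrightarrow> algebraic_int (x - y)"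
  using algebraic_int_add[of x "- y"] by auto

lemma algebraic_int_ev: "algebraic_int x \<Longrightarrow> algebraic_int (ev p x)"
  by (induction p) (auto intro: algebraic_int_add algebraic_int_mult)

lemma algebraic_int_power: "algebraic_int (x :: complex) \<Longrightarrow> algebraic_int (x ^ n)"
  using algebraic_int_ev[of x "monom 1 n"] by simp

lemma algebraic_int_sum: "(\<And>i. i \<in> A \<Longrightarrow> algebraic_int (f i :: complex)) \<Longrightarrow> algebraic_int (sum f A)"
  by (induction A rule: infinite_finite_induct) (auto intro: algebraic_int_add)

lemma algebraic_int_prod: "(\<And>i. i \<in> A \<Longrightarrow> algebraic_int (f i :: complex)) \<Longrightarrow> algebraic_int (prod f A)"
  by (induction A rule: infinite_finite_induct) (auto intro: algebraic_int_mult simp: int_imp_algebraic_int)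

lemma algebraic_int_det:
  assumes A: "A \<in> carrier_mat n n" and "\<And>i j. i < n \<Longrightarrow> j < n \<Longrightarrow> algebraic_int (A $$ (i, j) :: complex)"
  shows "algebraic_int (det A)"
  unfolding det_def'[OF A]
proof (intro algebraic_int_sum algebraic_int_mult algebraic_int_prod)
  fix p assume "p \<in> {p. p permutes {0..<n}}"
  then show "algebraic_int (A $$ (i, p i))" if "i \<in> {0..<n}" for i
    using that assms(2) permutes_in_image[of p "{0..<n}" i] by auto
  show "algebraic_int (signof p :: complex)"
    by (cases p rule: sign_cases) (auto simp: int_imp_algebraic_int)
qed

section \<open>Number fields with a power basis\<close>

definition rv :: "rat poly \<Rightarrow> complex \<Rightarrow> complex" where
  "rv p x = poly (map_poly of_rat p) x"

interpretation of_rat_poly_hom: map_poly_inj_idom_hom of_rat ..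

lemma rv_0 [simp]: "rv 0 x = 0"
  and rv_1 [simp]: "rv 1 x = 1"
  and rv_add [simp]: "rv (p + q) x = rv p x + rv q x"
  and rv_diff [simp]: "rv (p - q) x = rv p x - rv q x"
  and rv_uminus [simp]: "rv (- p) x = - rv p x"
  and rv_mult [simp]: "rv (p * q) x = rv p x * rv q x"
  and rv_pCons [simp]: "rv (pCons a p) x = of_rat a + x * rv p x"
  and rv_smult [simp]: "rv (smult a p) x = of_rat a * rv p x"
  and rv_monom [simp]: "rv (monom a n) x = of_rat a * x ^ n"
  by (simp_all add: rv_def of_rat_poly_hom.hom_add of_rat_poly_hom.hom_minus of_rat_poly_hom.hom_uminus
    of_rat_poly_hom.hom_mult of_rat_hom.map_poly_pCons_hom of_rat_hom.map_poly_hom_smult poly_monom)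

lemma rv_sum [simp]: "rv (sum f A) x = (\<Sum>i\<in>A. rv (f i) x)"
  by (induction A rule: infinite_finite_induct) auto

lemma rv_of_int_poly [simp]: "rv (map_poly of_int p) x = ev p x"
  by (simp add: rv_def ev_def map_poly_map_poly o_def)

lemma rv_altdef:
  assumes "degree p < n"
  shows "rv p x = (\<Sum>i<n. of_rat (coeff p i) * x ^ i)"
proof -
  have "(\<Sum>i<n. monom (coeff p i) i) = p"
    using assms by (intro poly_eqI) (auto simp: coeff_sum coeff_eq_0)
  then have "rv p x = rv (\<Sum>i<n. monom (coeff p i) i) x" by simp
  then show ?thesis by simp
qed

text \<open>The general coefficient domain lets the same division serve integer and rational
  polynomials.\<close>

lemma monic_division:
  fixes g :: "'a :: idom poly"
  assumes g: "lead_coeff g = 1" "degree g > 0"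
  shows "\<exists>q r. f = g * q + r \<and> degree r < degree g"
proof (induction "degree f" arbitrary: f rule: less_induct)
  case less
  show ?case
  proof (cases "degree f < degree g")
    case True
    then show ?thesis by (intro exI[of _ 0] exI[of _ f]) auto
  next
    case False
    define h where "h = monom (lead_coeff f) (degree f - degree g)"
    have f0: "f \<noteq> 0" using False g by auto
    then have "h \<noteq> 0" "degree h = degree f - degree g" "lead_coeff h = lead_coeff f"
      by (auto simp: h_def degree_monom_eq monom_eq_0_iff)
    moreover have "g \<noteq> 0" using g by auto
    ultimately have "degree (g * h) = degree f" "lead_coeff (g * h) = lead_coeff f"
      using False g lead_coeff_mult[of g h] by (auto simp: degree_mult_eq)
    then have "degree (f - g * h) \<le> degree f" "coeff (f - g * h) (degree f) = 0"
      by (auto intro: degree_diff_le)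
    then have "degree (f - g * h) < degree f"
      using False g by (metis degree_0 le_neq_implies_less leading_coeff_0_iff not_gr_zero)
    from less[OF this] obtain q r where "f - g * h = g * q + r" "degree r < degree g" by blast
    then have "f = g * (h + q) + r" by (simp add: algebra_simps)
    then show ?thesis using \<open>degree r < degree g\<close> by blast
  qed
qed

text \<open>With the last node replaced by a variable \<open>y\<close>, the determinant is a
  polynomial \<open>P\<close> of degree at most \<open>n\<close> that vanishes at the other
  \<open>n\<close> nodes. So it is \<open>c n\<close>, its coefficient at \<open>n\<close>, times
  the product of the linear factors; the difference would have degree below \<open>n\<close> and
  \<open>n\<close> zeros.\<close>

lemma det_vandermonde_Suc:
  fixes f :: "nat \<Rightarrow> 'a :: idom"
  assumes inj: "inj_on f {..<Suc n}"
  shows "det (mat (Suc n) (Suc n) (\<lambda>(i, j). f i ^ j)) =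
    det (mat n n (\<lambda>(i, j). f i ^ j)) * (\<Prod>i<n. f n - f i)"
proof -
  define W where "W y = mat (Suc n) (Suc n) (\<lambda>(i, j). (if i = n then y else f i) ^ j)" for y
  define c where "c j = cofactor (W 0) n j" for j
  define P where "P = (\<Sum>j\<le>n. monom (c j) j)"
  have P: "poly P y = det (W y)" for y
  proof -
    have "det (W y) = (\<Sum>j<Suc n. W y $$ (n, j) * cofactor (W y) n j)"
      by (rule laplace_expansion_row) (auto simp: W_def)
    also have "\<dots> = (\<Sum>j\<le>n. y ^ j * c j)"
    proof (rule sum.cong)
      fix j assume j: "j \<in> {..n}"
      have "mat_delete (W y) n j = mat_delete (W 0) n j"
        by (auto simp: mat_delete_def W_def)
      then show "W y $$ (n, j) * cofactor (W y) n j = y ^ j * c j"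
        using j by (simp add: W_def c_def cofactor_def)
    qed auto
    finally show ?thesis by (simp add: P_def poly_sum poly_monom mult.commute)
  qed
  have cn: "c n = det (mat n n (\<lambda>(i, j). f i ^ j))"
  proof -
    have "mat_delete (W 0) n n = mat n n (\<lambda>(i, j). f i ^ j)"
      by (rule eq_matI) (auto simp: mat_delete_def W_def)
    then show ?thesis by (simp add: c_def cofactor_def)
  qed
  define Q where "Q = smult (c n) (\<Prod>i<n. [:- f i, 1:])"
  have degQ: "degree (\<Prod>i<n. [:- f i, 1:]) = n"
    by (subst degree_prod_eq_sum_degree) auto
  have monQ: "lead_coeff (\<Prod>i<n. [:- f i, 1:]) = 1"
    by (simp add: lead_coeff_prod)
  have "P = Q"
  proof (rule ccontr)
    assume "P \<noteq> Q"
    then have D: "P - Q \<noteq> 0" by simp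
    have "coeff P n = c n" by (simp add: P_def coeff_sum)
    moreover have "coeff Q n = c n" using degQ monQ by (simp add: Q_def)
    moreover have "degree P \<le> n" unfolding P_def
      by (intro degree_sum_le) (auto intro: order_trans[OF degree_monom_le])
    moreover have "degree Q \<le> n" using degQ by (simp add: Q_def)
    ultimately have "degree (P - Q) \<le> n" "coeff (P - Q) n = 0"
      by (auto intro: degree_diff_le)
    then have "degree (P - Q) < n"
      using D by (metis le_neq_implies_less leading_coeff_0_iff)
    moreover have "f ` {..<n} \<subseteq> {x. poly (P - Q) x = 0}"
    proof safe
      fix i assume i: "i < n"
      have "det (W (f i)) = 0"
        by (rule Determinant.det_identical_rows[of _ "Suc n" i n]) (use i in \<open>auto simp: W_def\<close>)
      moreover have "poly Q (f i) = 0" using i by (auto simp: Q_def poly_prod)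
      ultimately show "poly (P - Q) (f i) = 0" by (simp add: P)
    qed
    then have "card (f ` {..<n}) \<le> degree (P - Q)"
      using card_mono[OF poly_roots_finite[OF D]] card_poly_roots_bound[OF D] by (meson order_trans)
    moreover have "card (f ` {..<n}) = n"
      using inj by (subst card_image) (auto simp: inj_on_def)
    ultimately show False by simp
  qed
  then have "det (W (f n)) = poly Q (f n)" using P by simp
  moreover have "W (f n) = mat (Suc n) (Suc n) (\<lambda>(i, j). f i ^ j)"
    by (rule eq_matI) (auto simp: W_def)
  ultimately show ?thesis by (simp add: Q_def poly_prod cn)
qed

lemma det_vandermonde:
  fixes f :: "nat \<Rightarrow> 'a :: idom"
  assumes "inj_on f {..<n}"
  shows "det (mat n n (\<lambda>(i, j). f i ^ j)) = (\<Prod>j<n. \<Prod>i<j. f j - f i)"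
  using assms
proof (induction n)
  case 0
  then show ?case by (simp add: det_dim_zero)
next
  case (Suc n)
  have "inj_on f {..<n}" using Suc.prems by (auto simp: inj_on_def)
  then show ?case using Suc by (simp add: det_vandermonde_Suc)
qed

section \<open>The field \<open>\<rat>(\<theta>)\<close>, its coordinates in the power basis, and
  the roots of \<open>Phi\<close>\<close>

locale monic_irreducible =
  fixes Phi :: "int poly" and th :: complex
  assumes monic: "lead_coeff Phi = 1"
    and irred: "irreducible (map_poly of_int Phi :: rat poly)"
    and root: "ev Phi th = 0"
begin

definition N where "N = degree Phi"
text \<open>The very choice made inside \<open>poly_discriminant\<close>, so that \<open>D\<close>
  unfolds to a product over this list.\<close>

definition xs :: "complex list" where "xs = (SOME xs. mset xs = proots (map_poly of_int Phi))"
definition x :: "nat \<Rightarrow> complex" where "x k = xs ! k"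
definition K where "K = rat_adjoin th"
definition D where "D = poly_discriminant (map_poly of_int Phi)"

lemma N_pos: "N > 0"
proof (rule ccontr)
  assume "\<not> N > 0"
  then have "degree (map_poly of_int Phi :: rat poly) = 0" by (simp add: N_def)
  moreover have "map_poly of_int Phi \<noteq> (0 :: rat poly)" using monic by auto
  ultimately have "is_unit (map_poly of_int Phi :: rat poly)"
    by (simp add: is_unit_iff_degree)
  then show False using irred by (simp add: irreducible_def)
qed

lemma rat_bezout:
  assumes "\<not> map_poly of_int Phi dvd (p :: rat poly)"
  obtains u v where "u * map_poly of_int Phi + v * p = 1"
proof -
  have "coprime (map_poly of_int Phi) p"
    by (rule prime_elem_imp_coprime[OF field_poly_irreducible_imp_prime[OF irred] assms])
  then have "gcd (map_poly of_int Phi) p = 1" by (rule coprime_imp_gcd_eq_1)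
  then show thesis
    by (metis that bezout_coefficients_fst_snd)
qed

lemma rat_min_poly:
  assumes "rv p th = 0"
  shows "map_poly of_int Phi dvd p"
proof (rule ccontr)
  assume "\<not> ?thesis"
  then obtain u v where "u * map_poly of_int Phi + v * p = 1" by (rule rat_bezout)
  then have "rv (u * map_poly of_int Phi + v * p) th = 1" by simp
  then show False using assms root by simp
qed

lemma rat_poly_eq_0:
  assumes "rv p th = 0" "degree p < N"
  shows "p = 0"
  using dvd_imp_degree_le[OF rat_min_poly[OF assms(1)]] assms(2) by (auto simp: N_def)

text \<open>This makes the conjugation \<open>rv p th \<mapsto> rv p y\<close> well defined.\<close>

lemma root_transfer:
  assumes "rv p th = 0" "ev Phi y = 0"
  shows "rv p y = 0"
  using rat_min_poly[OF assms(1)] assms(2) by (auto elim!: dvdE)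

lemma int_division: "\<exists>q r. b = Phi * q + r \<and> degree r < N"
  using monic_division[OF monic] N_pos by (auto simp: N_def)

lemma rat_division: "\<exists>q r. (b :: rat poly) = map_poly of_int Phi * q + r \<and> degree r < N"
  using monic_division[of "map_poly of_int Phi :: rat poly" b] monic N_pos
  by (auto simp: N_def)

text \<open>Division by the monic \<open>Phi\<close> stays within integer polynomials, and the
  remainder vanishes because it does so over the rationals.\<close>

lemma int_min_poly:
  assumes "ev b th = 0"
  shows "Phi dvd b"
proof -
  obtain q r where qr: "b = Phi * q + r" "degree r < N" using int_division by blast
  then have "rv (map_poly of_int r) th = 0" using assms root by simp
  then have "map_poly of_int r = (0 :: rat poly)" using qr by (intro rat_poly_eq_0) auto
  then show ?thesis using qr by simp
qed

lemma K_eq: "K = range (\<lambda>p. rv p th)"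
proof
  have inv: "inverse (rv p th) \<in> range (\<lambda>p. rv p th)" for p
  proof (cases "rv p th = 0")
    case True
    then show ?thesis by (auto intro: image_eqI[of _ _ 0])
  next
    case False
    then have "\<not> map_poly of_int Phi dvd p" using root by (auto elim!: dvdE)
    then obtain u v where "u * map_poly of_int Phi + v * p = 1" by (rule rat_bezout)
    then have "rv (u * map_poly of_int Phi + v * p) th = 1" by simp
    then have "rv v th * rv p th = 1" using root by simp
    then have "inverse (rv p th) = rv v th" using False by (metis inverse_unique mult.commute)
    then show ?thesis by auto
  qed
  have "complex_subfield (range (\<lambda>p. rv p th))"
    unfolding complex_subfield_def
  proof (intro conjI ballI)
    show "0 \<in> range (\<lambda>p. rv p th)" by (rule image_eqI[of _ _ 0]) auto
    show "1 \<in> range (\<lambda>p. rv p th)" by (rule image_eqI[of _ _ 1]) auto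
    fix a assume "a \<in> range (\<lambda>p. rv p th)"
    then obtain p where p: "a = rv p th" by auto
    show "- a \<in> range (\<lambda>p. rv p th)" by (rule image_eqI[of _ _ "- p"]) (auto simp: p)
    show "inverse a \<in> range (\<lambda>p. rv p th)" using inv by (simp add: p)
    fix b assume "b \<in> range (\<lambda>p. rv p th)"
    then obtain q where q: "b = rv q th" by auto
    show "a + b \<in> range (\<lambda>p. rv p th)" by (rule image_eqI[of _ _ "p + q"]) (auto simp: p q)
    show "a * b \<in> range (\<lambda>p. rv p th)" by (rule image_eqI[of _ _ "p * q"]) (auto simp: p q)
  qed
  moreover have "th \<in> range (\<lambda>p. rv p th)" by (rule image_eqI[of _ _ "[:0, 1:]"]) auto
  ultimately show "K \<subseteq> range (\<lambda>p. rv p th)" by (auto simp: K_def rat_adjoin_def)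
  have "rv p th \<in> F" if F: "complex_subfield F" "th \<in> F" for p F
  proof -
    have nat: "of_nat n \<in> F" for n using F(1) by (induction n) (auto simp: complex_subfield_def)
    have int: "of_int k \<in> F" for k
      by (cases k rule: int_cases2) (use nat F(1) in \<open>auto simp: complex_subfield_def\<close>)
    have rat: "of_rat r \<in> F" for r
    proof -
      obtain a b where "r = Rat.Fract a b" "b > 0" by (cases r) auto
      then have "(of_rat r :: complex) = of_int a * inverse (of_int b)"
        by (simp add: of_rat_rat divide_inverse)
      then show ?thesis using int[of a] int[of b] F(1) by (auto simp: complex_subfield_def)
    qed
    show ?thesis
      by (induction p) (use rat rat[of 0] F in \<open>auto simp: complex_subfield_def\<close>)
  qed
  then show "range (\<lambda>p. rv p th) \<subseteq> K" by (auto simp: K_def rat_adjoin_def)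
qed

text \<open>Packs the coordinates of \<open>z\<close> in the power basis into one polynomial; for
  \<open>z\<close> in \<open>K\<close> the choice is unique by \<open>rat_poly_eq_0\<close>.\<close>

definition co :: "complex \<Rightarrow> rat poly" where
  "co z = (SOME p. degree p < N \<and> rv p th = z)"

lemma co:
  assumes "z \<in> K"
  shows degree_co: "degree (co z) < N" and rv_co: "rv (co z) th = z"
proof -
  obtain b where b: "z = rv b th" using assms K_eq by auto
  obtain q r where "b = map_poly of_int Phi * q + r" "degree r < N" using rat_division by blast
  then have "degree r < N \<and> rv r th = z" using b root by simp
  then have "degree (co z) < N \<and> rv (co z) th = z" unfolding co_def by (rule someI)
  then show "degree (co z) < N" "rv (co z) th = z" by auto
qed

lemma rv_in_K [simp, intro]: "rv p th \<in> K"
  by (auto simp: K_eq)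

lemma ev_in_K [simp, intro]: "ev p th \<in> K"
  using rv_in_K[of "map_poly of_int p"] by simp

lemma th_in_K [simp, intro]: "th \<in> K"
  using ev_in_K[of "[:0, 1:]"] by simp

lemma of_rat_in_K [simp, intro]: "of_rat r \<in> K"
  using rv_in_K[of "[:r:]"] by simp

lemma of_int_in_K [simp, intro]: "of_int r \<in> K"
  using of_rat_in_K[of "of_int r"] by simp

lemma K_add: "a \<in> K \<Longrightarrow> b \<in> K \<Longrightarrow> a + b \<in> K"
  using rv_co rv_in_K by (metis rv_add)

lemma K_mult: "a \<in> K \<Longrightarrow> b \<in> K \<Longrightarrow> a * b \<in> K"
  using rv_co rv_in_K by (metis rv_mult)

lemma K_diff: "a \<in> K \<Longrightarrow> b \<in> K \<Longrightarrow> a - b \<in> K"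
  using rv_co rv_in_K by (metis rv_diff)

lemma K_sum: "(\<And>i. i \<in> A \<Longrightarrow> f i \<in> K) \<Longrightarrow> sum f A \<in> K"
  by (induction A rule: infinite_finite_induct) (use of_int_in_K[of 0] in \<open>auto intro: K_add\<close>)

lemma co_rv:
  assumes "degree p < N"
  shows "co (rv p th) = p"
proof -
  have "degree (co (rv p th) - p) < N" using degree_co[OF rv_in_K] assms by (meson degree_diff_less)
  moreover have "rv (co (rv p th) - p) th = 0" using rv_co[OF rv_in_K] by simp
  ultimately show ?thesis using rat_poly_eq_0 by fastforce
qed

lemma co_ev:
  assumes "degree p < N"
  shows "co (ev p th) = map_poly of_int p"
  using co_rv[of "map_poly of_int p"] assms by simp

lemma co_add: "a \<in> K \<Longrightarrow> b \<in> K \<Longrightarrow> co (a + b) = co a + co b"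
  using co_rv[of "co a + co b"] by (simp add: co degree_add_less)

lemma co_scale: "a \<in> K \<Longrightarrow> co (of_rat r * a) = smult r (co a)"
  using co_rv[of "smult r (co a)"] le_less_trans[OF degree_smult_le degree_co] by (simp add: co)

lemma co_sum: "(\<And>i. i \<in> A \<Longrightarrow> f i \<in> K) \<Longrightarrow> co (sum f A) = (\<Sum>i\<in>A. co (f i))"
proof (induction A rule: infinite_finite_induct)
  case (insert i A)
  then show ?case by (simp add: co_add K_sum)
qed (use co_rv[of 0] N_pos in auto)

lemma mset_xs: "mset xs = proots (map_poly of_int Phi)"
  unfolding xs_def by (rule someI_ex) (rule ex_mset)

lemma length_xs: "length xs = N"
  using arg_cong[OF mset_xs, of size] by (simp add: size_proots_complex N_def)

lemma Phi_neq_0: "Phi \<noteq> 0"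
  using monic by auto

lemma set_xs: "set xs = {y. ev Phi y = 0}"
  using arg_cong[OF mset_xs, of set_mset] Phi_neq_0 by (simp add: ev_def)

lemma ev_Phi_x: "k < N \<Longrightarrow> ev Phi (x k) = 0"
  using set_xs length_xs nth_mem[of k xs] by (auto simp: x_def)

text \<open>The derivative is nonzero of smaller degree, hence prime to the irreducible
  \<open>Phi\<close> over the rationals, and the Bezout relation excludes a common complex
  zero.\<close>

lemma rsquarefree_Phi: "rsquarefree (map_poly of_int Phi :: complex poly)"
  unfolding rsquarefree_roots
proof (intro allI notI)
  fix a :: complex assume a: "poly (map_poly of_int Phi) a = 0 \<and> poly (pderiv (map_poly of_int Phi)) a = 0"
  have "degree (pderiv Phi) < N" "pderiv Phi \<noteq> 0"
    using N_pos by (auto simp: N_def degree_pderiv pderiv_eq_0_iff)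
  then have "rv (map_poly of_int (pderiv Phi)) th \<noteq> 0"
    using rat_poly_eq_0[of "map_poly of_int (pderiv Phi)"] by auto
  then have "\<not> map_poly of_int Phi dvd (map_poly of_int (pderiv Phi) :: rat poly)"
    using root by (auto elim!: dvdE simp del: rv_of_int_poly) (simp)
  then obtain u v where "u * map_poly of_int Phi + v * map_poly of_int (pderiv Phi) = (1 :: rat poly)"
    by (rule rat_bezout)
  then have "rv (u * map_poly of_int Phi + v * map_poly of_int (pderiv Phi)) a = 1"
    by (simp only: rv_1)
  moreover have "ev (pderiv Phi) a = 0" "ev Phi a = 0"
    using a by (auto simp: ev_def of_int_hom.map_poly_pderiv)
  ultimately show False unfolding rv_add rv_mult rv_of_int_poly by simp
qed

lemma distinct_xs: "distinct xs"
proof -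
  have "count (mset xs) y \<le> 1" for y
    using rsquarefree_Phi Phi_neq_0 unfolding mset_xs
    by (auto simp: rsquarefree_def dest: spec[of _ y])
  then show ?thesis
    by (metis count_mset_0_iff distinct_count_atmost_1 le_neq_implies_less less_one)
qed

lemma inj_x: "inj_on x {..<N}"
  using distinct_xs length_xs by (auto simp: x_def inj_on_def nth_eq_iff_index_eq)

lemma x_image: "x ` {..<N} = {y. ev Phi y = 0}"
  unfolding set_xs[symmetric] using length_xs by (auto simp: x_def set_conv_nth)

lemma Phi_factor: "map_poly of_int Phi = (\<Prod>k<N. [:- x k, 1:])"
proof -
  have "(\<Prod>y\<in>#proots (map_poly of_int Phi :: complex poly). [:- y, 1:]) = prod_list (map (\<lambda>y. [:- y, 1:]) xs)"
    unfolding mset_xs[symmetric] by (simp add: prod_mset_prod_list[symmetric])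
  also have "\<dots> = (\<Prod>k<N. [:- x k, 1:])"
    by (simp add: prod.list_conv_set_nth length_xs x_def atLeast0LessThan)
  finally show ?thesis
    using complex_poly_decompose_multiset[of "map_poly of_int Phi"] monic by simp
qed

end

section \<open>Embeddings, the trace form and the discriminant of a basis\<close>

context monic_irreducible begin

text \<open>The embedding of \<open>K\<close> that sends \<open>th\<close> to the root
  \<open>x k\<close>.\<close>

definition sg :: "nat \<Rightarrow> complex \<Rightarrow> complex" where "sg k z = rv (co z) (x k)"
definition OK where "OK = ring_of_integers K"
definition V where "V = mat N N (\<lambda>(k, i). x k ^ i)"
definition cmat :: "complex list \<Rightarrow> rat mat" where
  "cmat bs = mat N N (\<lambda>(i, j). coeff (co (bs ! j)) i)"

lemma sg_rv:
  assumes "k < N"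
  shows "sg k (rv p th) = rv p (x k)"
proof -
  have "rv (co (rv p th) - p) th = 0" using rv_co[of "rv p th"] by simp
  from root_transfer[OF this ev_Phi_x[OF assms]] show ?thesis by (simp add: sg_def)
qed

lemma sg_ev: "k < N \<Longrightarrow> sg k (ev p th) = ev p (x k)"
  using sg_rv[of k "map_poly of_int p"] by simp

lemma sg_hom:
  assumes "k < N" "a \<in> K" "b \<in> K"
  shows "sg k (a + b) = sg k a + sg k b" "sg k (a * b) = sg k a * sg k b"
  using sg_rv[OF assms(1), of "co a + co b"] sg_rv[OF assms(1), of "co a * co b"] assms
  by (simp_all add: rv_co sg_def)

lemma sg_1: "k < N \<Longrightarrow> sg k 1 = 1"
  using sg_ev[of k 1] by simp

lemma sg_th: "k < N \<Longrightarrow> sg k th = x k"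
  using sg_ev[of k "[:0, 1:]"] by simp

lemma field_hom_rv:
  assumes "\<sigma> 1 = 1" and hom: "\<And>a b. a \<in> K \<Longrightarrow> b \<in> K \<Longrightarrow> \<sigma> (a + b) = \<sigma> a + \<sigma> b \<and> \<sigma> (a * b) = \<sigma> a * \<sigma> b"
  shows "\<sigma> (rv p th) = rv p (\<sigma> th)"
proof -
  have zero: "\<sigma> 0 = 0" using hom[of 0 0] of_int_in_K[of 0] by simp
  have nat: "\<sigma> (of_nat n) = of_nat n" for n
  proof (induction n)
    case (Suc n)
    then show ?case using hom[of 1 "of_nat n"] of_int_in_K[of 1] of_int_in_K[of "int n"] assms(1) by simp
  qed (simp add: zero)
  have int: "\<sigma> (of_int k) = of_int k" for k
  proof (cases k rule: int_cases2)
    case (nonpos n)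
    have "\<sigma> (of_int k) + \<sigma> (of_nat n) = \<sigma> (of_int k + of_nat n)"
      using hom[of "of_int k" "of_nat n"] of_int_in_K[of k] of_int_in_K[of "int n"] by simp
    then show ?thesis using nonpos zero nat[of n] by (simp add: add_eq_0_iff2)
  qed (simp add: nat)
  have rat: "\<sigma> (of_rat r) = of_rat r" for r
  proof -
    obtain a b where r: "r = Rat.Fract a b" "b > 0" by (cases r) auto
    then have r': "of_int b * (of_rat r :: complex) = of_int a" by (simp add: of_rat_rat)
    then have "\<sigma> (of_int b) * \<sigma> (of_rat r) = \<sigma> (of_int a)" using hom[of "of_int b" "of_rat r"] by simp
    then have "of_int b * \<sigma> (of_rat r) = of_int b * of_rat r" unfolding int r' .
    then show ?thesis using r by simp
  qed
  show ?thesis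
  proof (induction p)
    case (pCons c p)
    then show ?case using hom[of "of_rat c" "th * rv p th"] hom[of th "rv p th"]
      by (simp add: K_mult rat)
  qed (simp add: zero)
qed

text \<open>An embedding fixes the rationals, so it is determined by the image of \<open>th\<close>,
  which is again a root of \<open>Phi\<close>.\<close>

lemma field_embeddings_eq: "field_embeddings K = (\<lambda>k. restrict (sg k) K) ` {..<N}"
proof
  show "field_embeddings K \<subseteq> (\<lambda>k. restrict (sg k) K) ` {..<N}"
  proof
    fix \<sigma> assume \<sigma>: "\<sigma> \<in> field_embeddings K"
    then have ext: "\<sigma> \<in> extensional K"
      and rv: "\<And>p. \<sigma> (rv p th) = rv p (\<sigma> th)" unfolding field_embeddings_def
      using field_hom_rv[of \<sigma>] by auto
    have "ev Phi (\<sigma> th) = \<sigma> 0" using rv[of "map_poly of_int Phi"] root by simp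
    also have "\<dots> = 0" using rv[of 0] by simp
    finally obtain k where k: "k < N" "\<sigma> th = x k" using x_image by force
    have "\<sigma> = restrict (sg k) K"
    proof (rule extensionalityI[OF ext])
      fix z assume z: "z \<in> K"
      then show "\<sigma> z = restrict (sg k) K z" using rv[of "co z"] rv_co[OF z] k by (simp add: sg_def)
    qed auto
    then show "\<sigma> \<in> (\<lambda>k. restrict (sg k) K) ` {..<N}" using k by auto
  qed
  show "(\<lambda>k. restrict (sg k) K) ` {..<N} \<subseteq> field_embeddings K"
    using of_int_in_K[of 1] by (auto simp: field_embeddings_def sg_hom sg_1 K_add K_mult)
qed

lemma field_trace_eq:
  assumes "z \<in> K"
  shows "field_trace K z = (\<Sum>k<N. sg k z)"
proof -
  have "inj_on (\<lambda>k. restrict (sg k) K) {..<N}"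
  proof (rule inj_onI)
    fix i j assume ij: "i \<in> {..<N}" "j \<in> {..<N}" "restrict (sg i) K = restrict (sg j) K"
    from fun_cong[OF ij(3), of th] have "sg i th = sg j th" by simp
    then have "x i = x j" using ij(1,2) by (simp add: sg_th)
    then show "i = j" using inj_x ij by (auto simp: inj_on_def)
  qed
  then show ?thesis
    using assms by (simp add: field_trace_def field_embeddings_eq sum.reindex)
qed

lemma V_carrier [simp]: "V \<in> carrier_mat N N"
  by (simp add: V_def)

lemma cmat_carrier [simp]: "cmat bs \<in> carrier_mat N N"
  by (simp add: cmat_def)

lemma D_eq: "D = (det V)\<^sup>2"
proof -
  have "D = (\<Prod>(i, j)\<in>{(i, j). i < j \<and> j < N}. (x j - x i)\<^sup>2)"
    unfolding D_def poly_discriminant_def xs_def[symmetric] Let_def length_xs x_def ..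
  also have "\<dots> = (\<Prod>(j, i)\<in>(SIGMA j:{..<N}. {..<j}). (x j - x i)\<^sup>2)"
    by (rule prod.reindex_bij_witness[of _ "\<lambda>(j, i). (i, j)" "\<lambda>(i, j). (j, i)"]) auto
  also have "\<dots> = (\<Prod>j<N. \<Prod>i<j. (x j - x i)\<^sup>2)"
    by (rule prod.Sigma[symmetric]) auto
  also have "\<dots> = (det V)\<^sup>2"
    unfolding V_def det_vandermonde[OF inj_x] by (simp add: prod_power_distrib)
  finally show ?thesis .
qed

lemma det_V_neq_0: "det V \<noteq> 0"
proof -
  have "x j - x i \<noteq> 0" if "j < N" "i < j" for i j
    using inj_onD[OF inj_x, of j i] that by auto
  then show ?thesis unfolding V_def det_vandermonde[OF inj_x] by auto
qed

lemma sg_eq_sum: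
  assumes "z \<in> K"
  shows "sg k z = (\<Sum>i<N. of_rat (coeff (co z) i) * x k ^ i)"
  unfolding sg_def by (rule rv_altdef) (rule degree_co[OF assms])

lemma K_eq_sum:
  assumes "z \<in> K"
  shows "z = (\<Sum>i<N. of_rat (coeff (co z) i) * th ^ i)"
  using rv_altdef[OF degree_co[OF assms], of th] rv_co[OF assms] by simp

lemma embedding_matrix:
  assumes "set bs \<subseteq> K" "length bs = N"
  shows "mat N N (\<lambda>(k, j). sg k (bs ! j)) = V * map_mat of_rat (cmat bs)"
proof (rule eq_matI)
  fix k j assume kj: "k < dim_row (V * map_mat of_rat (cmat bs))" "j < dim_col (V * map_mat of_rat (cmat bs))"
  then have kj: "k < N" "j < N" by (auto simp: V_def cmat_def)
  then have "bs ! j \<in> K" using assms by auto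
  then show "mat N N (\<lambda>(k, j). sg k (bs ! j)) $$ (k, j) = (V * map_mat of_rat (cmat bs)) $$ (k, j)"
    using kj by (simp add: sg_eq_sum V_def cmat_def scalar_prod_def atLeast0LessThan mult.commute)
qed (auto simp: V_def cmat_def)

lemma det_embedding_matrix:
  assumes "set bs \<subseteq> K" "length bs = N"
  shows "det (mat N N (\<lambda>(k, j). sg k (bs ! j))) = det V * of_rat (det (cmat bs))"
  unfolding embedding_matrix[OF assms] by (subst det_mult[of _ N]) (auto simp: cmat_def)

text \<open>The Gram matrix of the trace form is \<open>A\<^sup>T * A\<close> for the matrix
  \<open>A\<close> of all conjugates, and \<open>A\<close> is \<open>V\<close> times the coordinate
  matrix.\<close>

lemma basis_discriminant_eq:
  assumes "set bs \<subseteq> K" "length bs = N"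
  shows "basis_discriminant K bs = D * of_rat ((det (cmat bs))\<^sup>2)"
proof -
  define A where "A = mat N N (\<lambda>(k, j). sg k (bs ! j))"
  have A: "A \<in> carrier_mat N N" by (simp add: A_def)
  have "mat (length bs) (length bs) (\<lambda>(i, j). field_trace K (bs ! i * bs ! j)) = A\<^sup>T * A"
  proof (rule eq_matI)
    fix i j assume "i < dim_row (A\<^sup>T * A)" "j < dim_col (A\<^sup>T * A)"
    then have ij: "i < N" "j < N" by (auto simp: A_def)
    then have "bs ! i \<in> K" "bs ! j \<in> K" using assms by auto
    then show "mat (length bs) (length bs) (\<lambda>(i, j). field_trace K (bs ! i * bs ! j)) $$ (i, j) = (A\<^sup>T * A) $$ (i, j)"
      using ij assms by (simp add: field_trace_eq K_mult A_def sg_hom scalar_prod_def atLeast0LessThan)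
  qed (use assms in \<open>auto simp: A_def\<close>)
  then have "basis_discriminant K bs = (det A)\<^sup>2"
    unfolding basis_discriminant_def using A by (simp add: det_mult[of _ N] det_transpose power2_eq_square)
  then show ?thesis
    unfolding A_def det_embedding_matrix[OF assms] D_eq by (simp add: power_mult_distrib of_rat_power)
qed

lemma OK_K: "z \<in> OK \<Longrightarrow> z \<in> K"
  by (auto simp: OK_def ring_of_integers_def)

lemma OK_algebraic_int: "z \<in> OK \<Longrightarrow> algebraic_int z"
  by (auto simp: OK_def ring_of_integers_def)

lemma OK_I: "z \<in> K \<Longrightarrow> algebraic_int z \<Longrightarrow> z \<in> OK"
  by (auto simp: OK_def ring_of_integers_def)

lemma th_algebraic_int: "algebraic_int th"
  using monic root algebraic_int_iff_ev by blast

lemma ev_in_OK [simp, intro]: "ev b th \<in> OK"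
  using th_algebraic_int by (auto intro: OK_I algebraic_int_ev)

lemma sg_ev_gen:
  assumes "k < N" "z \<in> K"
  shows "sg k (ev p z) = ev p (sg k z)" and "ev p z \<in> K"
proof -
  have "sg k (ev p z) = ev p (sg k z) \<and> ev p z \<in> K"
  proof (induction p)
    case 0
    then show ?case using sg_ev[OF assms(1), of 0] of_int_in_K[of 0] by simp
  next
    case (pCons c p)
    moreover have "sg k (of_int c) = of_int c" using sg_ev[OF assms(1), of "[:c:]"] by simp
    ultimately show ?case using assms by (simp add: sg_hom K_mult K_add)
  qed
  then show "sg k (ev p z) = ev p (sg k z)" "ev p z \<in> K" by auto
qed

lemma algebraic_int_sg:
  assumes "k < N" "z \<in> OK"
  shows "algebraic_int (sg k z)"
proof -
  obtain p where p: "lead_coeff p = 1" "ev p z = 0"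
    using OK_algebraic_int[OF assms(2)] algebraic_int_iff_ev by blast
  have "ev p (sg k z) = sg k 0" using sg_ev_gen(1)[OF assms(1) OK_K[OF assms(2)], of p] p by simp
  then have "ev p (sg k z) = 0" using sg_ev[OF assms(1), of 0] by simp
  then show ?thesis using p algebraic_int_iff_ev by blast
qed

end

locale monic_irreducible_disc = monic_irreducible +
  fixes d :: int
  assumes D_sq: "D\<^sup>2 = of_int d"
begin

lemma d_neq_0: "d \<noteq> 0"
  using D_sq D_eq det_V_neq_0 by auto

text \<open>This is the fourth power of the determinant of all conjugates: an algebraic integer, and
  rational because \<open>D\<^sup>2 = det V ^ 4\<close> is an integer.\<close>

lemma disc_power_int:
  assumes "set bs \<subseteq> OK" "length bs = N"
  shows "of_int d * (det (cmat bs)) ^ 4 \<in> \<int>"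
proof -
  define A where "A = mat N N (\<lambda>(k, j). sg k (bs ! j))"
  have "algebraic_int (det A)"
    using assms by (intro algebraic_int_det[of _ N]) (auto simp: A_def intro!: algebraic_int_sg)
  then have "algebraic_int (det A ^ 4)" by (rule algebraic_int_power)
  moreover have "det A ^ 4 = D\<^sup>2 * of_rat (det (cmat bs)) ^ 4"
    unfolding A_def using assms OK_K by (subst det_embedding_matrix) (auto simp: D_eq power_mult_distrib)
  ultimately have ai: "algebraic_int (of_rat (of_int d * det (cmat bs) ^ 4) :: complex)"
    by (simp add: D_sq of_rat_mult of_rat_power)
  then have "(of_rat (of_int d * det (cmat bs) ^ 4) :: complex) \<in> \<int>"
    by (rule rational_algebraic_int_is_int) simp
  then obtain k where "(of_rat (of_int d * det (cmat bs) ^ 4) :: complex) = of_rat (of_int k)"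
    by (auto elim: Ints_cases)
  then show ?thesis unfolding of_rat_eq_iff by simp
qed

end

section \<open>Integral bases\<close>

lemma common_denominator: "\<exists>e::int. e > 0 \<and> (\<forall>j<(m::nat). of_int e * (r j :: rat) \<in> \<int>)"
proof (induction m)
  case 0
  show ?case by (intro exI[of _ 1]) auto
next
  case (Suc m)
  then obtain e where e: "e > 0" "\<forall>j<m. of_int e * r j \<in> \<int>" by blast
  obtain a b where r: "r m = Rat.Fract a b" "b > 0" by (cases "r m") auto
  then have "of_int b * r m = of_int a" by (simp add: Fract_of_int_quotient)
  then have "of_int b * r m \<in> \<int>" by simp
  have "of_int (e * b) * r j \<in> \<int>" if "j < Suc m" for j
  proof (cases "j = m")
    case True
    have "of_int e * (of_int b * r m) \<in> \<int>"
      using \<open>of_int b * r m \<in> \<int>\<close> by (rule Ints_mult[OF Ints_of_int])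
    then show ?thesis using True by (simp add: mult.assoc)
  next
    case False
    have "of_int b * (of_int e * r j) \<in> \<int>"
      using e(2) that False by (rule_tac Ints_mult[OF Ints_of_int]) simp
    then show ?thesis by (simp add: mult_ac)
  qed
  then show ?case using e(1) r(2) by (intro exI[of _ "e * b"]) simp
qed

context monic_irreducible_disc begin

lemma OK_diff: "a \<in> OK \<Longrightarrow> b \<in> OK \<Longrightarrow> a - b \<in> OK"
  by (auto intro!: OK_I K_diff algebraic_int_diff dest: OK_K OK_algebraic_int)

lemma OK_mult: "a \<in> OK \<Longrightarrow> b \<in> OK \<Longrightarrow> a * b \<in> OK"
  by (auto intro!: OK_I K_mult algebraic_int_mult dest: OK_K OK_algebraic_int)

lemma OK_of_int [simp, intro]: "of_int k \<in> OK"
  by (auto intro!: OK_I)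

lemma coeff_co_0: "N \<le> i \<Longrightarrow> z \<in> K \<Longrightarrow> coeff (co z) i = 0"
  by (intro coeff_eq_0 less_le_trans[OF degree_co])

lemma co_eq_iff:
  assumes "a \<in> K" "b \<in> K"
  shows "a = b \<longleftrightarrow> (\<forall>i<N. coeff (co a) i = coeff (co b) i)"
proof
  assume *: "\<forall>i<N. coeff (co a) i = coeff (co b) i"
  have "co a = co b"
  proof (rule poly_eqI)
    fix i show "coeff (co a) i = coeff (co b) i"
      using * assms coeff_co_0[of i] by (cases "i < N") auto
  qed
  then show "a = b" using rv_co assms by metis
qed simp

lemma coeff_co_lincomb:
  assumes "set bs \<subseteq> K"
  shows "coeff (co (\<Sum>j<length bs. of_rat (r j) * bs ! j)) i = (\<Sum>j<length bs. r j * coeff (co (bs ! j)) i)"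
proof -
  have "bs ! j \<in> K" if "j < length bs" for j using that assms by auto
  then have "co (\<Sum>j<length bs. of_rat (r j) * bs ! j) = (\<Sum>j<length bs. co (of_rat (r j) * bs ! j))"
    and "(\<Sum>j<length bs. co (of_rat (r j) * bs ! j)) = (\<Sum>j<length bs. smult (r j) (co (bs ! j)))"
    by (auto intro!: co_sum K_mult sum.cong co_scale)
  then show ?thesis by (simp add: coeff_sum)
qed

lemma lincomb_K:
  assumes "set bs \<subseteq> K"
  shows "(\<Sum>j<length bs. of_rat (r j) * bs ! j) \<in> K"
  using assms nth_mem by (intro K_sum K_mult) auto

lemma lincomb_iff:
  assumes bs: "set bs \<subseteq> K" "length bs = N" and z: "z \<in> K"
  shows "z = (\<Sum>j<N. of_rat (r j) * bs ! j) \<longleftrightarrow> vec N (coeff (co z)) = cmat bs *\<^sub>v vec N r"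
  unfolding co_eq_iff[OF z lincomb_K[OF bs(1), unfolded bs(2)]]
  using coeff_co_lincomb[OF bs(1), of r]
  by (auto simp: vec_eq_iff cmat_def scalar_prod_def atLeast0LessThan mult.commute bs(2))

lemma cmat_solve:
  assumes "det (cmat bs) \<noteq> 0" "v \<in> carrier_vec N"
  obtains y where "cmat bs *\<^sub>v vec N y = v"
proof -
  define C where "C = cmat bs"
  have C: "C \<in> carrier_mat N N" by (simp add: C_def)
  define y where "y = (1 / det C) \<cdot>\<^sub>v (adj_mat C *\<^sub>v v)"
  have y: "y \<in> carrier_vec N"
    unfolding y_def by (intro smult_carrier_vec[THEN iffD2] mult_mat_vec_carrier[OF adj_mat(1)[OF C] assms(2)])
  have "C *\<^sub>v y = (1 / det C) \<cdot>\<^sub>v (C *\<^sub>v (adj_mat C *\<^sub>v v))"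
    unfolding y_def by (rule mult_mat_vec[OF C mult_mat_vec_carrier[OF adj_mat(1)[OF C] assms(2)]])
  also have "C *\<^sub>v (adj_mat C *\<^sub>v v) = (C * adj_mat C) *\<^sub>v v"
    using adj_mat(1)[OF C] C assms(2) by (intro assoc_mult_mat_vec[symmetric]) auto
  also have "\<dots> = det C \<cdot>\<^sub>v v"
    unfolding adj_mat(2)[OF C] using assms(2) by auto
  finally have "C *\<^sub>v y = v" using assms by (simp add: C_def smult_smult_assoc)
  moreover have "y = vec N (\<lambda>i. y $ i)" using y by auto
  ultimately show thesis using that unfolding C_def by metis
qed

lemma cmat_unique:
  assumes "det (cmat bs) \<noteq> 0" and "cmat bs *\<^sub>v vec N r = cmat bs *\<^sub>v vec N s"
  shows "\<forall>i<N. r i = s i"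
proof -
  define C where "C = cmat bs"
  have C: "C \<in> carrier_mat N N" by (simp add: C_def)
  have "adj_mat C *\<^sub>v (C *\<^sub>v vec N r) = det C \<cdot>\<^sub>v vec N r" for r
  proof -
    have "adj_mat C *\<^sub>v (C *\<^sub>v vec N r) = (adj_mat C * C) *\<^sub>v vec N r"
      using adj_mat(1)[OF C] C by (intro assoc_mult_mat_vec[symmetric]) auto
    then show ?thesis unfolding adj_mat(3)[OF C] by auto
  qed
  then have "det C \<cdot>\<^sub>v vec N r = det C \<cdot>\<^sub>v vec N s" using assms(2) unfolding C_def by metis
  then show ?thesis using assms(1) by (auto simp: vec_eq_iff C_def)
qed

text \<open>Among the lists of \<open>N\<close> linearly independent integers of \<open>K\<close>, one with minimal discriminant
  is an integral basis: a non-integral coordinate could be replaced by its fractional part.\<close>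

lemma integral_basis_exists: "\<exists>bs. integral_basis K bs"
proof -
  define P where "P bs \<longleftrightarrow> length bs = N \<and> set bs \<subseteq> OK \<and> det (cmat bs) \<noteq> 0" for bs
  \<comment> \<open>On \<open>P\<close> the value under the floor is a positive integer, by
    \<open>disc_power_int\<close> and \<open>d_neq_0\<close>; the conversion to a natural number
    only makes a least element available.\<close>
  define \<mu> where "\<mu> bs = nat \<lfloor>\<bar>of_int d * det (cmat bs) ^ 4\<bar>\<rfloor>" for bs
  have "P (map (\<lambda>i. th ^ i) [0..<N])"
  proof -
    have co: "co (th ^ i) = monom 1 i" if "i < N" for i
      using co_rv[of "monom 1 i"] that by (simp add: degree_monom_eq)
    have "cmat (map (\<lambda>i. th ^ i) [0..<N]) = 1\<^sub>m N"
      by (rule eq_matI) (auto simp: cmat_def co)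
    moreover have "th ^ i \<in> OK" for i using ev_in_OK[of "monom 1 i"] by simp
    ultimately show ?thesis by (auto simp: P_def)
  qed
  then obtain bs where bs: "P bs" and min: "\<And>cs. P cs \<Longrightarrow> \<mu> bs \<le> \<mu> cs"
    using ex_has_least_nat[of P _ \<mu>] by blast
  then have len: "length bs = N" and sub: "set bs \<subseteq> OK" and nz: "det (cmat bs) \<noteq> 0"
    by (auto simp: P_def)
  have subK: "set bs \<subseteq> K" using sub OK_K by auto
  have C: "cmat bs \<in> carrier_mat N N" by simp
  have real_\<mu>: "of_nat (\<mu> cs) = \<bar>of_int d * det (cmat cs) ^ 4\<bar>" if cs: "P cs" for cs
  proof -
    have "of_int d * det (cmat cs) ^ 4 \<in> \<int>" using cs by (intro disc_power_int) (auto simp: P_def)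
    then obtain k where k: "of_int d * det (cmat cs) ^ 4 = of_int k" by (auto elim: Ints_cases)
    show ?thesis unfolding \<mu>_def k by (simp add: of_nat_nat)
  qed
  have int_coords: "y j \<in> \<int>" if z: "z \<in> OK" "z = (\<Sum>j<N. of_rat (y j) * bs ! j)" and j: "j < N" for z y j
  proof (rule ccontr)
    assume nint: "y j \<notin> \<int>"
    define w where "w = z - of_int \<lfloor>y j\<rfloor> * bs ! j"
    define y' where "y' = y(j := frac (y j))"
    have bj: "bs ! j \<in> OK" using sub j len by auto
    have w: "w \<in> OK" unfolding w_def by (intro OK_diff OK_mult z bj) auto
    have "w = (\<Sum>i<N. of_rat (y i) * bs ! i) - of_rat (of_int \<lfloor>y j\<rfloor>) * bs ! j"
      unfolding w_def by (subst z(2)) simp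
    also have "\<dots> = (\<Sum>i<N. of_rat (y' i) * bs ! i)"
    proof -
      have "(\<Sum>i<N. of_rat (f i) * bs ! i) = of_rat (f j) * bs ! j + (\<Sum>i\<in>{..<N} - {j}. of_rat (f i) * bs ! i)" for f
        using j by (subst sum.remove[of _ j]) auto
      from this[of y] this[of y'] show ?thesis
        by (simp add: y'_def frac_def of_rat_diff algebra_simps)
    qed
    finally have vw: "vec N (coeff (co w)) = cmat bs *\<^sub>v vec N y'"
      using lincomb_iff[OF subK len OK_K[OF w]] by simp
    define cs where "cs = bs[j := w]"
    \<comment> \<open>Cramer's rule: exchanging column \<open>j\<close> for the coordinates of
      \<open>w\<close> multiplies the determinant by the \<open>j\<close>-th coordinate of
      \<open>w\<close> in \<open>bs\<close>, the fractional part of \<open>y j\<close>.\<close>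
    have "cmat cs = replace_col (cmat bs) (vec N (coeff (co w))) j"
      using j len by (intro eq_matI) (auto simp: replace_col_def cmat_def cs_def nth_list_update)
    then have det: "det (cmat cs) = frac (y j) * det (cmat bs)"
      unfolding vw using cramer_lemma_mat[OF C, of "vec N y'" j] j by (simp add: y'_def)
    have fr: "0 < frac (y j)" "frac (y j) < 1" using nint by (auto simp: frac_lt_1 frac_gt_0_iff)
    have "P cs" unfolding P_def
    proof (intro conjI)
      show "length cs = N" by (simp add: cs_def len)
      show "set cs \<subseteq> OK" unfolding cs_def using set_update_subset_insert[of bs j w] sub w by auto
      show "det (cmat cs) \<noteq> 0" using det fr nz by simp
    qed
    have "rat_of_nat (\<mu> cs) = frac (y j) ^ 4 * rat_of_nat (\<mu> bs)"
      unfolding real_\<mu>[OF \<open>P cs\<close>] real_\<mu>[OF bs] det by (simp add: abs_mult power_mult_distrib)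
    moreover have "frac (y j) ^ 4 < 1" using fr by (intro power_Suc_less_one[of _ 3, simplified]) auto
    moreover have "rat_of_nat (\<mu> bs) > 0" unfolding real_\<mu>[OF bs] using nz d_neq_0 by simp
    ultimately have "rat_of_nat (\<mu> cs) < rat_of_nat (\<mu> bs)" by simp
    then show False using min[OF \<open>P cs\<close>] by simp
  qed
  have "integral_basis K bs"
    unfolding integral_basis_def OK_def[symmetric]
  proof (intro conjI ballI)
    fix z assume z: "z \<in> OK"
    obtain y where "cmat bs *\<^sub>v vec N y = vec N (coeff (co z))"
      using cmat_solve[OF nz] by (metis vec_carrier)
    then have zy: "z = (\<Sum>j<N. of_rat (y j) * bs ! j)"
      using lincomb_iff[OF subK len OK_K[OF z]] by simp
    have yi: "y j = of_int \<lfloor>y j\<rfloor>" if "j < N" for j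
      using int_coords[OF z zy that] by (auto elim: Ints_cases)
    show "\<exists>!cs. length cs = length bs \<and> z = (\<Sum>i<length bs. of_int (cs ! i) * bs ! i)"
    proof (rule ex1I[of _ "map (\<lambda>j. \<lfloor>y j\<rfloor>) [0..<N]"])
      have "(\<Sum>i<N. of_rat (y i) * bs ! i) = (\<Sum>i<N. of_int \<lfloor>y i\<rfloor> * bs ! i)"
      proof (rule sum.cong)
        fix i assume "i \<in> {..<N}"
        then have "of_rat (y i) = (of_rat (of_int \<lfloor>y i\<rfloor>) :: complex)" using yi[of i] by simp
        then show "of_rat (y i) * bs ! i = of_int \<lfloor>y i\<rfloor> * bs ! i" by simp
      qed simp
      then show "length (map (\<lambda>j. \<lfloor>y j\<rfloor>) [0..<N]) = length bs \<and>
          z = (\<Sum>i<length bs. of_int (map (\<lambda>j. \<lfloor>y j\<rfloor>) [0..<N] ! i) * bs ! i)"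
        using zy by (simp add: len)
    next
      fix cs assume cs: "length cs = length bs \<and> z = (\<Sum>i<length bs. of_int (cs ! i) * bs ! i)"
      then have "z = (\<Sum>i<N. of_rat (of_int (cs ! i)) * bs ! i)" by (simp add: len)
      then have "vec N (coeff (co z)) = cmat bs *\<^sub>v vec N (\<lambda>i. of_int (cs ! i))"
        using lincomb_iff[OF subK len OK_K[OF z], of "\<lambda>i. of_int (cs ! i)"] by simp
      then have "\<forall>i<N. of_int (cs ! i) = y i"
        using \<open>cmat bs *\<^sub>v vec N y = _\<close> by (intro cmat_unique[OF nz]) simp
      then show "cs = map (\<lambda>j. \<lfloor>y j\<rfloor>) [0..<N]"
        using cs by (intro nth_equalityI) (auto simp: len, metis floor_of_int)
    qed
  qed (use sub in auto)
  then show ?thesis by blast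
qed

text \<open>\<open>integral_basis\<close> leaves the length open. Expanding the powers of
  \<open>th\<close> in the basis gives an integer matrix that is a two-sided inverse of the
  coordinate matrix, and this fixes the length.\<close>

lemma integral_basis_inverse:
  assumes "integral_basis K bs"
  obtains M where "length bs = N" "M \<in> carrier_mat N N" "cmat bs * map_mat of_int M = 1\<^sub>m N"
proof -
  define m where "m = length bs"
  have sub: "set bs \<subseteq> OK" and ex1: "\<And>z. z \<in> OK \<Longrightarrow>
      \<exists>!cs. length cs = m \<and> z = (\<Sum>i<m. of_int (cs ! i) * bs ! i)"
    using assms by (auto simp: integral_basis_def OK_def m_def)
  have subK: "set bs \<subseteq> K" using sub OK_K by auto
  \<comment> \<open>Clearing denominators turns a rational relation into an integral expansion of
    \<open>0\<close>, which is unique and hence trivial.\<close>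
  have indep: "\<forall>j<m. r j = 0" if r: "(\<Sum>j<m. of_rat (r j) * bs ! j) = 0" for r
  proof -
    obtain e :: int where e: "e > 0" "\<forall>j<m. of_int e * r j \<in> \<int>" using common_denominator by blast
    have er: "of_int \<lfloor>of_int e * r j\<rfloor> = of_int e * r j" if "j < m" for j
      using e that by (auto elim: Ints_cases)
    define cs where "cs = map (\<lambda>j. \<lfloor>of_int e * r j\<rfloor>) [0..<m]"
    have "of_int (cs ! i) * bs ! i = of_int e * (of_rat (r i) * bs ! i)" if "i < m" for i
    proof -
      have "(of_rat (of_int \<lfloor>of_int e * r i\<rfloor>) :: complex) = of_rat (of_int e * r i)"
        unfolding er[OF that] ..
      then show ?thesis using that by (simp add: cs_def of_rat_mult)
    qed
    then have "(\<Sum>i<m. of_int (cs ! i) * bs ! i) = of_int e * (\<Sum>i<m. of_rat (r i) * bs ! i)"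
      unfolding sum_distrib_left by (intro sum.cong) simp_all
    then have "length cs = m \<and> 0 = (\<Sum>i<m. of_int (cs ! i) * bs ! i)" using r by (simp add: cs_def)
    moreover have "length (replicate m 0) = m \<and> (0::complex) = (\<Sum>i<m. of_int (replicate m 0 ! i) * bs ! i)" by simp
    ultimately have "cs = replicate m 0"
      using ex1[of 0] OK_of_int[of 0] unfolding of_int_0 by blast
    then have "\<lfloor>of_int e * r j\<rfloor> = 0" if "j < m" for j
      using that by (metis (no_types, lifting) add_0 cs_def diff_zero length_upt nth_map nth_replicate nth_upt)
    then show ?thesis using er e(1) by (metis mult_eq_0_iff of_int_0 of_int_eq_0_iff order_less_irrefl)
  qed
  have "\<forall>i. \<exists>cs. length cs = m \<and> th ^ i = (\<Sum>j<m. of_int (cs ! j) * bs ! j)"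
    using ex1 ev_in_OK[of "monom 1 _"] by (metis ev_monom mult_1 of_int_1)
  then obtain c where c: "\<And>i. th ^ i = (\<Sum>j<m. of_int (c i ! j) * bs ! j)" by metis
  define C where "C i j = coeff (co (bs ! j)) i" for i j
  have bsK: "bs ! j \<in> K" if "j < m" for j using subK that by (auto simp: m_def)
  have CM: "(\<Sum>j<m. C i' j * of_int (c i ! j)) = (if i' = i then 1 else 0)" if "i < N" "i' < N" for i i'
  proof -
    have "coeff (co (th ^ i)) i' = (\<Sum>j<m. of_int (c i ! j) * C i' j)"
      using coeff_co_lincomb[OF subK, of "\<lambda>j. of_int (c i ! j)" i'] c[of i] by (simp add: m_def C_def)
    moreover have "co (th ^ i) = monom 1 i"
      using co_rv[of "monom 1 i"] that by (simp add: degree_monom_eq)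
    ultimately show ?thesis using that by (simp add: mult.commute eq_commute)
  qed
  have MC: "(\<Sum>i<N. of_int (c i ! j) * C i k) = (if j = k then 1 else 0)" if "j < m" "k < m" for j k
  proof -
    have "bs ! k = (\<Sum>i<N. of_rat (C i k) * (\<Sum>j<m. of_int (c i ! j) * bs ! j))"
      unfolding c[symmetric] C_def by (rule K_eq_sum) (rule bsK[OF that(2)])
    also have "\<dots> = (\<Sum>i<N. \<Sum>j<m. of_rat (C i k) * of_int (c i ! j) * bs ! j)"
      by (simp add: sum_distrib_left mult.assoc)
    also have "\<dots> = (\<Sum>j<m. \<Sum>i<N. of_rat (C i k) * of_int (c i ! j) * bs ! j)"
      by (rule sum.swap)
    also have "\<dots> = (\<Sum>j<m. of_rat (\<Sum>i<N. of_int (c i ! j) * C i k) * bs ! j)"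
      by (intro sum.cong) (simp_all add: of_rat_sum of_rat_mult sum_distrib_right mult.commute[of "of_rat _"])
    finally have e: "bs ! k = (\<Sum>j<m. of_rat (\<Sum>i<N. of_int (c i ! j) * C i k) * bs ! j)" .
    have "(\<Sum>j<m. of_rat ((\<Sum>i<N. of_int (c i ! j) * C i k) - (if j = k then 1 else 0)) * bs ! j) =
        (\<Sum>j<m. of_rat (\<Sum>i<N. of_int (c i ! j) * C i k) * bs ! j) - (\<Sum>j<m. (if j = k then bs ! j else 0))"
      unfolding sum_subtractf[symmetric] by (intro sum.cong) (auto simp: of_rat_diff left_diff_distrib)
    also have "\<dots> = 0" using that by (subst e[symmetric]) simp
    finally have "\<forall>j<m. (\<Sum>i<N. of_int (c i ! j) * C i k) - (if j = k then 1 else 0) = 0"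
      by (rule indep)
    then show ?thesis using that(1) unfolding right_minus_eq by blast
  qed
  \<comment> \<open>The two products of the matrices are identities of sizes \<open>N\<close> and
    \<open>m\<close>; their traces agree.\<close>
  have "rat_of_nat N = (\<Sum>i<N. \<Sum>j<m. C i j * of_int (c i ! j))"
    using CM by simp
  also have "\<dots> = (\<Sum>j<m. \<Sum>i<N. of_int (c i ! j) * C i j)"
    by (subst sum.swap) (simp add: mult.commute)
  also have "\<dots> = rat_of_nat m" using MC by simp
  finally have "N = m" by simp
  show thesis
  proof (rule that)
    show "length bs = N" using \<open>N = m\<close> m_def by simp
    show "mat N N (\<lambda>(j, i). c i ! j) \<in> carrier_mat N N" by simp
    show "cmat bs * map_mat of_int (mat N N (\<lambda>(j, i). c i ! j)) = 1\<^sub>m N"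
    proof (rule eq_matI)
      fix i j assume ij: "i < dim_row (1\<^sub>m N)" "j < dim_col (1\<^sub>m N)"
      then show "(cmat bs * map_mat of_int (mat N N (\<lambda>(j, i). c i ! j))) $$ (i, j) = 1\<^sub>m N $$ (i, j)"
        using CM[of j i] by (simp add: cmat_def C_def \<open>N = m\<close> scalar_prod_def atLeast0LessThan)
    qed (auto simp: cmat_def)
  qed
qed

lemma ints_square_1:
  assumes "(a :: rat) * of_int b = 1"
  shows "a \<in> \<int> \<Longrightarrow> a\<^sup>2 = 1"
  using assms by (auto elim!: Ints_cases simp: zmult_eq_1_iff simp flip: of_int_mult)

theorem field_discriminant_iff:
  "D = field_discriminant K \<longleftrightarrow> OK \<subseteq> range (\<lambda>b. ev b th)"
proof -
  define bs where "bs = (SOME bs. integral_basis K bs)"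
  have ib: "integral_basis K bs" unfolding bs_def by (rule someI_ex) (rule integral_basis_exists)
  from integral_basis_inverse[OF ib] obtain M where len: "length bs = N"
    and M: "M \<in> carrier_mat N N" and CM: "cmat bs * map_mat of_int M = 1\<^sub>m N" by blast
  define C where "C = cmat bs"
  have C: "C \<in> carrier_mat N N" by (simp add: C_def)
  define M' :: "rat mat" where "M' = map_mat of_int M"
  have M': "M' \<in> carrier_mat N N" using M by (simp add: M'_def)
  have sub: "set bs \<subseteq> OK" using ib by (auto simp: integral_basis_def OK_def)
  then have subK: "set bs \<subseteq> K" using OK_K by auto
  have detM: "det M' = of_int (det M)" unfolding M'_def by (rule of_int_hom.hom_det)
  have det1: "det C * of_int (det M) = 1"
    using arg_cong[OF CM, of det] det_mult[OF C M'] detM by (simp add: C_def M'_def)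
  have "field_discriminant K = D * of_rat ((det C)\<^sup>2)"
    unfolding field_discriminant_def bs_def[symmetric] C_def by (rule basis_discriminant_eq[OF subK len])
  moreover have "D \<noteq> 0" using D_eq det_V_neq_0 by simp
  ultimately have "D = field_discriminant K \<longleftrightarrow> of_rat ((det C)\<^sup>2) = (of_rat 1 :: complex)"
    by auto
  then have "D = field_discriminant K \<longleftrightarrow> (det C)\<^sup>2 = 1" unfolding of_rat_eq_iff .
  also have "\<dots> \<longleftrightarrow> OK \<subseteq> range (\<lambda>b. ev b th)"
  proof
    assume "(det C)\<^sup>2 = 1"
    then have "det C \<in> \<int>" by (auto simp: power2_eq_1_iff)
    \<comment> \<open>\<open>C\<close> is the inverse of the integer matrix \<open>M'\<close>, so it
      equals \<open>det C\<close> times the adjugate of \<open>M'\<close>; as \<open>det C\<close>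
      is an integer, \<open>C\<close> is integral.\<close>
    have adj: "adj_mat M' = det M' \<cdot>\<^sub>m C"
    proof -
      have "adj_mat M' = (C * M') * adj_mat M'"
        using CM adj_mat(1)[OF M'] by (simp add: C_def M'_def)
      also have "\<dots> = C * (M' * adj_mat M')" using C M' adj_mat(1)[OF M'] by simp
      also have "\<dots> = det M' \<cdot>\<^sub>m C" unfolding adj_mat(2)[OF M'] mult_smult_distrib[OF C one_carrier_mat] right_mult_one_mat[OF C] ..
      finally show ?thesis .
    qed
    have adjM: "adj_mat M' = map_mat of_int (adj_mat M)"
    proof (rule eq_matI)
      fix i j assume ij: "i < dim_row (map_mat of_int (adj_mat M))" "j < dim_col (map_mat of_int (adj_mat M))"
      have "mat_delete M' j i = map_mat of_int (mat_delete M j i)"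
        using M by (auto simp: mat_delete_def M'_def intro!: eq_matI)
      then show "adj_mat M' $$ (i, j) = map_mat of_int (adj_mat M) $$ (i, j)"
        using ij M M' by (simp add: adj_mat_def cofactor_def)
    qed (use M M' in \<open>auto simp: adj_mat_def\<close>)
    have "C = det C \<cdot>\<^sub>m adj_mat M'"
      unfolding adj using det1 C by (auto simp: detM mult.assoc[symmetric])
    then have Cint: "C $$ (i, j) \<in> \<int>" if "i < N" "j < N" for i j
      using that M \<open>det C \<in> \<int>\<close> adj_mat(1)[OF M] adj_mat(1)[OF M']
      by (metis (no_types, lifting) Ints_mult Ints_of_int adjM carrier_matD index_map_mat(1) index_smult_mat(1))
    have bsev: "\<exists>b. bs ! j = ev b th" if j: "j < N" for j
    proof -
      have "\<forall>i<N. \<exists>k. coeff (co (bs ! j)) i = of_int k"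
        using Cint[OF _ j] j by (auto simp: C_def cmat_def elim!: Ints_cases)
      then obtain k where k: "\<And>i. i < N \<Longrightarrow> coeff (co (bs ! j)) i = of_int (k i)" by metis
      have "bs ! j \<in> K" using subK j len by auto
      from K_eq_sum[OF this] have "bs ! j = (\<Sum>i<N. of_int (k i) * th ^ i)" by (simp add: k)
      then have "bs ! j = ev (\<Sum>i<N. monom (k i) i) th" by simp
      then show ?thesis by blast
    qed
    show "OK \<subseteq> range (\<lambda>b. ev b th)"
    proof
      fix z assume "z \<in> OK"
      then obtain cs where z: "z = (\<Sum>i<N. of_int (cs ! i) * bs ! i)"
        using ib len unfolding integral_basis_def OK_def[symmetric] by metis
      obtain b where "\<And>j. j < N \<Longrightarrow> bs ! j = ev (b j) th" using bsev by metis
      then have "z = ev (\<Sum>i<N. smult (cs ! i) (b i)) th" by (simp add: z)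
      then show "z \<in> range (\<lambda>b. ev b th)" by blast
    qed
  next
    assume sub': "OK \<subseteq> range (\<lambda>b. ev b th)"
    have "C $$ (i, j) \<in> \<int>" if ij: "i < N" "j < N" for i j
    proof -
      have "bs ! j \<in> range (\<lambda>b. ev b th)"
        using subsetD[OF sub'] subsetD[OF sub] nth_mem[of j bs] ij(2) len by simp
      then obtain b where b: "bs ! j = ev b th" by auto
      obtain q r where qr: "b = Phi * q + r" "degree r < N" using int_division by blast
      then have "bs ! j = ev r th" using root b by simp
      then have "co (bs ! j) = map_poly of_int r" using co_ev[OF qr(2)] by simp
      then show ?thesis using ij by (simp add: C_def cmat_def)
    qed
    then have "\<forall>i j. \<exists>k. i < N \<longrightarrow> j < N \<longrightarrow> C $$ (i, j) = of_int k" by (metis Ints_cases)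
    then obtain k where k: "\<And>i j. i < N \<Longrightarrow> j < N \<Longrightarrow> C $$ (i, j) = of_int (k i j)" by metis
    have "C = map_mat of_int (mat N N (\<lambda>(i, j). k i j))"
      using C by (intro eq_matI) (auto simp: k)
    then have "det C \<in> \<int>" by (metis Ints_of_int of_int_hom.hom_det)
    then show "(det C)\<^sup>2 = 1" by (rule ints_square_1[OF det1])
  qed
  finally show ?thesis .
qed

end

section \<open>Maximality at a prime\<close>

lemma freshmans_dream_cong:
  fixes a b :: "'a :: comm_ring_1"
  assumes "prime p"
  shows "\<exists>c. (a + b) ^ p = a ^ p + b ^ p + of_nat p * c"
proof -
  have "\<exists>c. of_nat (p choose k) * a ^ k * b ^ (p - k) = of_nat p * c" if "k \<in> {1..<p}" for k
  proof -
    have "p dvd p choose k" using that assms by (intro dvd_choose_prime) auto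
    then obtain m where "p choose k = p * m" by blast
    then show ?thesis by (metis mult.assoc of_nat_mult)
  qed
  then obtain c where c: "\<And>k. k \<in> {1..<p} \<Longrightarrow> of_nat (p choose k) * a ^ k * b ^ (p - k) = of_nat p * c k"
    by metis
  have p: "p > 0" using assms prime_gt_0_nat by blast
  have "{..p} = insert 0 (insert p {1..<p})" using p by auto
  then have "(a + b) ^ p = b ^ p + (a ^ p + (\<Sum>k\<in>{1..<p}. of_nat (p choose k) * a ^ k * b ^ (p - k)))"
    unfolding binomial_ring using p by simp
  also have "(\<Sum>k\<in>{1..<p}. of_nat (p choose k) * a ^ k * b ^ (p - k)) = of_nat p * (\<Sum>k\<in>{1..<p}. c k)"
    by (simp add: c sum_distrib_left)
  finally show ?thesis by (metis add.assoc add.commute)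
qed

lemma prime_dvd_power_diff_self:
  fixes a :: int
  assumes "prime p"
  shows "int p dvd a ^ p - a"
proof (induction a rule: int_induct[of _ 0])
  case base
  show ?case using prime_gt_0_nat[OF assms] by (simp add: zero_power)
next
  case (step1 a)
  obtain c where "(a + 1) ^ p = a ^ p + 1 ^ p + of_nat p * c" using freshmans_dream_cong[OF assms] by blast
  then have "(a + 1) ^ p - (a + 1) = (a ^ p - a) + int p * c" by simp
  then show ?case using step1(2) by (simp only: dvd_add dvd_triv_left)
next
  case (step2 a)
  obtain c where "((a - 1) + 1) ^ p = (a - 1) ^ p + 1 ^ p + of_nat p * c" using freshmans_dream_cong[OF assms] by blast
  then have "(a - 1) ^ p - (a - 1) = (a ^ p - a) - int p * c" by simp
  then show ?case using step2(2) by (simp only: dvd_diff dvd_triv_left)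
qed

text \<open>Congruence modulo the ideal \<open>(f, p)\<close> of \<open>\<int>[X]\<close>; taking
  \<open>f = 0\<close> gives congruence modulo \<open>p\<close>. If \<open>Phi\<close> lies in the
  ideal, this is equality in \<open>\<int>[\<theta>]/(f(\<theta>), p)\<close>.\<close>

definition pcong :: "int poly \<Rightarrow> nat \<Rightarrow> int poly \<Rightarrow> int poly \<Rightarrow> bool" where
  "pcong f p g h \<longleftrightarrow> (\<exists>u v. g - h = f * u + of_nat p * v)"

lemma pcong_refl [simp]: "pcong f p g g"
  unfolding pcong_def by (intro exI[of _ 0]) simp

lemma pcong_sym: "pcong f p g h \<Longrightarrow> pcong f p h g"
  unfolding pcong_def
proof (elim exE)
  fix u v assume "g - h = f * u + of_nat p * v"
  then have "h - g = f * (- u) + of_nat p * (- v)" by (simp add: algebra_simps)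
  then show "\<exists>u v. h - g = f * u + of_nat p * v" by blast
qed

lemma pcong_add:
  assumes "pcong f p g h" "pcong f p g' h'"
  shows "pcong f p (g + g') (h + h')"
proof -
  obtain u v u' v' where "g - h = f * u + of_nat p * v" "g' - h' = f * u' + of_nat p * v'"
    using assms unfolding pcong_def by blast
  then have "(g + g') - (h + h') = f * (u + u') + of_nat p * (v + v')" by (simp add: algebra_simps)
  then show ?thesis unfolding pcong_def by blast
qed

lemma pcong_trans: "pcong f p g h \<Longrightarrow> pcong f p h k \<Longrightarrow> pcong f p g k"
  using pcong_add[of f p g h h k] by (simp add: pcong_def)

lemma pcong_mult:
  assumes "pcong f p g h" "pcong f p g' h'"
  shows "pcong f p (g * g') (h * h')"
proof -
  obtain u v u' v' where "g - h = f * u + of_nat p * v" "g' - h' = f * u' + of_nat p * v'"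
    using assms unfolding pcong_def by blast
  moreover have "g * g' - h * h' = (g - h) * g' + h * (g' - h')" by (simp add: algebra_simps)
  ultimately have "g * g' - h * h' = f * (u * g' + h * u') + of_nat p * (v * g' + h * v')"
    by (simp add: algebra_simps)
  then show ?thesis unfolding pcong_def by blast
qed

lemma pcong_power: "pcong f p g h \<Longrightarrow> pcong f p (g ^ n) (h ^ n)"
  by (induction n) (auto intro: pcong_mult)

lemma pcong_pcompose:
  assumes "pcong f p q q'"
  shows "pcong f p (pcompose g q) (pcompose g q')"
proof (induction g)
  case (pCons a g)
  show ?case unfolding pcompose_pCons by (intro pcong_add pcong_mult pcong_refl assms pCons)
qed simp

lemma pcong_pcompose_left:
  assumes "pcong 0 p g h"
  shows "pcong 0 p (pcompose g q) (pcompose h q)"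
proof -
  obtain v where "g - h = of_nat p * v" using assms unfolding pcong_def by auto
  then have "pcompose g q - pcompose h q = of_nat p * pcompose v q"
    by (simp add: pcompose_diff[symmetric] pcompose_smult of_nat_poly)
  then show ?thesis unfolding pcong_def by auto
qed

lemma pcong_weaken: "pcong 0 p g h \<Longrightarrow> pcong f p g h"
  unfolding pcong_def by (metis add_0 mult_zero_left mult_zero_right)

text \<open>Modulo \<open>p\<close>, raising to the power \<open>p\<close> is additive and, by
  Fermat, fixes the coefficients.\<close>

lemma pcong_frobenius:
  assumes "prime p"
  shows "pcong 0 p (g ^ p) (pcompose g (monom 1 p))"
proof (induction g)
  case 0
  then show ?case using prime_gt_0_nat[OF assms] by (simp add: zero_power)
next
  case (pCons a g)
  obtain c where "([:a:] + [:0, 1:] * g) ^ p = [:a:] ^ p + ([:0, 1:] * g) ^ p + of_nat p * c"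
    using freshmans_dream_cong[OF assms] by blast
  moreover have "[:a:] + [:0, 1:] * g = pCons a g" by simp
  ultimately have "pCons a g ^ p - ([:a:] ^ p + ([:0, 1:] * g) ^ p) = 0 * 0 + of_nat p * c" by simp
  then have 1: "pcong 0 p (pCons a g ^ p) ([:a:] ^ p + ([:0, 1:] * g) ^ p)"
    unfolding pcong_def by blast
  obtain m where m: "a ^ p - a = int p * m" using prime_dvd_power_diff_self[OF assms] by blast
  have "[:a:] ^ p - [:a:] = [:a ^ p - a:]" by (simp add: poly_const_pow)
  also have "\<dots> = of_nat p * [:m:]" unfolding m by (simp add: of_nat_poly)
  finally have "[:a:] ^ p - [:a:] = 0 * 0 + of_nat p * [:m:]" by simp
  then have 2: "pcong 0 p ([:a:] ^ p) [:a:]" unfolding pcong_def by blast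
  have "([:0, 1:] * g) ^ p = monom 1 p * g ^ p" by (simp only: power_mult_distrib monom_altdef smult_1_left)
  then have 3: "pcong 0 p (([:0, 1:] * g) ^ p) (monom 1 p * pcompose g (monom 1 p))"
    using pCons(2) by (auto intro: pcong_mult)
  show ?case
    using pcong_trans[OF 1 pcong_add[OF 2 3]] by (simp add: pcompose_pCons)
qed

lemma pcong_frobenius_power:
  assumes "prime p"
  shows "pcong 0 p (g ^ (p ^ k)) (pcompose g (monom 1 (p ^ k)))"
proof (induction k)
  case 0
  have "pcompose g (monom 1 1) = g" by (simp add: monom_altdef pcompose_idR)
  then show ?case by simp
next
  case (Suc k)
  have "g ^ (p ^ Suc k) = (g ^ (p ^ k)) ^ p" by (simp add: power_mult[symmetric] mult.commute)
  moreover have "pcong 0 p ((g ^ (p ^ k)) ^ p) (pcompose g (monom 1 (p ^ k)) ^ p)"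
    by (intro pcong_power Suc)
  moreover have "pcong 0 p (pcompose g (monom 1 (p ^ k)) ^ p) (pcompose (pcompose g (monom 1 (p ^ k))) (monom 1 p))"
    by (rule pcong_frobenius[OF assms])
  moreover have "pcompose (pcompose g (monom 1 (p ^ k))) (monom 1 p) = pcompose g (monom 1 (p ^ Suc k))"
    by (simp add: pcompose_assoc[symmetric] monom_altdef pcompose_hom.hom_power pcompose_pCons power_mult[symmetric])
  ultimately show ?case by (metis pcong_trans)
qed

text \<open>As \<open>X\<close> is fixed, raising to the power \<open>p ^ k\<close> is the identity
  modulo \<open>(f, p)\<close>. So \<open>b\<close> is congruent to its powers with exponents
  \<open>(p ^ k) ^ j\<close>, and one of these exponents exceeds \<open>m\<close>.\<close>

lemma pcong_reduced:
  assumes p: "prime p" and fix_x: "pcong f p (monom 1 (p ^ k)) [:0, 1:]" "k > 0"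
    and nil: "pcong f p (b ^ m) 0"
  shows "pcong f p b 0"
proof -
  have frob: "pcong f p (g ^ (p ^ k)) g" for g
    using pcong_trans[OF pcong_weaken[OF pcong_frobenius_power[OF p]] pcong_pcompose[OF fix_x(1)]]
    by (simp add: pcompose_idR)
  have iter: "pcong f p (b ^ ((p ^ k) ^ j)) b" for j
  proof (induction j)
    case (Suc j)
    have "b ^ ((p ^ k) ^ Suc j) = (b ^ ((p ^ k) ^ j)) ^ (p ^ k)" by (simp add: power_mult[symmetric] mult.commute)
    then show ?case using pcong_trans[OF frob Suc] by simp
  qed simp
  have "p ^ 1 \<le> p ^ k" using fix_x(2) prime_gt_0_nat[OF p] by (intro power_increasing) auto
  then have "2 \<le> p ^ k" using prime_ge_2_nat[OF p] by simp
  then have "m < (p ^ k) ^ m" by (meson less_exp less_le_trans power_mono zero_le)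
  then have "b ^ ((p ^ k) ^ m) = b ^ m * b ^ ((p ^ k) ^ m - m)" by (simp add: power_add[symmetric])
  moreover have "pcong f p (b ^ m * b ^ ((p ^ k) ^ m - m)) (0 * b ^ ((p ^ k) ^ m - m))"
    by (intro pcong_mult nil pcong_refl)
  ultimately show ?thesis using pcong_trans[OF pcong_sym[OF iter[of m]]] by simp
qed

text \<open>For an algebraic integer \<open>z\<close> this says that \<open>p\<close> does not
  divide the index of \<open>\<int>[z]\<close> in the ring of integers of its field.\<close>

definition maximal_at :: "complex \<Rightarrow> nat \<Rightarrow> bool" where
  "maximal_at z p \<longleftrightarrow> (\<forall>a. algebraic_int (ev a z / of_nat p) \<longrightarrow> (\<exists>b. ev a z = of_nat p * ev b z))"

section \<open>Criteria for maximality at a prime\<close>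

context monic_irreducible begin

lemma integral_multiple:
  assumes "z \<in> K"
  obtains e :: nat and a where "e > 0" "of_nat e * z = ev a th"
proof -
  obtain e :: int where e: "e > 0" "\<forall>i<N. of_int e * coeff (co z) i \<in> \<int>"
    using common_denominator by blast
  then have "\<forall>i. \<exists>k. i < N \<longrightarrow> of_int e * coeff (co z) i = of_int k" by (metis Ints_cases)
  then obtain k where k: "\<And>i. i < N \<Longrightarrow> of_int e * coeff (co z) i = of_int (k i)" by metis
  have "of_int e * z = (\<Sum>i<N. of_rat (of_int e * coeff (co z) i) * th ^ i)"
    by (subst K_eq_sum[OF assms]) (simp add: sum_distrib_left of_rat_mult mult.assoc)
  also have "\<dots> = ev (\<Sum>i<N. monom (k i) i) th" by (simp add: k)
  finally have "of_nat (nat e) * z = ev (\<Sum>i<N. monom (k i) i) th" using e(1) by simp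
  then show thesis by (rule that[rotated]) (use e(1) in simp)
qed

text \<open>An integer of \<open>K\<close> has some denominator with respect to
  \<open>\<int>[\<theta>]\<close>, which is stripped of its prime factors one at a time.\<close>

lemma OK_subset_if_maximal:
  assumes "\<And>p. prime p \<Longrightarrow> maximal_at th p"
  shows "OK \<subseteq> range (\<lambda>b. ev b th)"
proof
  fix z assume z: "z \<in> OK"
  have "\<exists>b. z = ev b th" if "of_nat e * z = ev a th" "e > 0" for e a
    using that
  proof (induction e arbitrary: a rule: less_induct)
    case (less e)
    show ?case
    proof (cases "e = 1")
      case True
      then show ?thesis using less by auto
    next
      case False
      then obtain p where p: "prime p" "p dvd e" using prime_factor_nat by blast
      then obtain e' where e': "e = p * e'" by blast
      have p0: "p > 1" using p prime_gt_1_nat by blast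
      have eq: "ev a th / of_nat p = of_nat e' * z" using less.prems p0 by (simp add: e' field_simps)
      have "algebraic_int (of_nat e' * z)"
        using algebraic_int_mult[OF algebraic_int_of_int[of "int e'"] OK_algebraic_int[OF z]] by simp
      then obtain b where "ev a th = of_nat p * ev b th"
        using assms[OF p(1)] eq unfolding maximal_at_def by metis
      then have "of_nat e' * z = ev b th" using eq p0 by (simp add: field_simps)
      moreover have "e' < e" "e' > 0" using p0 less.prems e' by auto
      ultimately show ?thesis using less.IH by blast
    qed
  qed
  then show "z \<in> range (\<lambda>b. ev b th)" using integral_multiple[OF OK_K[OF z]] by blast
qed

text \<open>If \<open>f(\<theta>)\<close> divides \<open>p\<close> up to a factor prime to \<open>p\<close> and \<open>\<int>[\<theta>]/(f(\<theta>), p)\<close> is reduced, then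
  locally at \<open>p\<close> the Jacobson radical of \<open>\<int>[\<theta>]\<close> is generated by \<open>f(\<theta>)\<close>, so \<open>\<int>[\<theta>]\<close> is
  maximal at \<open>p\<close>. Reducedness holds as a power of the Frobenius map is the identity.\<close>

lemma maximal_at_if_uniformizer:
  assumes p: "prime p" and fix_x: "pcong f p (monom 1 (p ^ k)) [:0, 1:]" "k > 0"
    and Phi: "pcong f p Phi 0"
    and q: "ev f th * ev q th = of_int (int p * s)" and s: "coprime s (int p)"
    and w: "ev f th ^ r = of_nat p * ev w th"
  shows "maximal_at th p"
  unfolding maximal_at_def
proof (intro allI impI)
  fix a define \<alpha> where "\<alpha> = ev a th / of_nat p"
  assume "algebraic_int (ev a th / of_nat p)"
  then have \<alpha>: "algebraic_int \<alpha>" by (simp add: \<alpha>_def)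
  have p0: "p > 1" using p prime_gt_1_nat by blast
  have s0: "s \<noteq> 0" using s p0 by auto
  have f0: "ev f th \<noteq> 0" using q s0 p0 by auto
  \<comment> \<open>Descent on the exponent: \<open>p\<close> divides \<open>f(\<theta>)^r\<close>,
    which settles \<open>j = r\<close>, and each step removes one factor \<open>f(\<theta>)\<close>
    at the price of the factor \<open>s\<close> in \<open>c\<close>. At \<open>j = 0\<close> only an
    integer prime to \<open>p\<close> remains.\<close>
  have "\<exists>c u. coprime c (int p) \<and> of_int c * ev f th ^ j * \<alpha> = ev u th" if "j \<le> r" for j
    using that
  proof (induction rule: inc_induct)
    case base
    have "of_int 1 * ev f th ^ r * \<alpha> = ev (w * a) th" using p0 w by (simp add: \<alpha>_def)
    then show ?case using coprime_1_left by blast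
  next
    case (step j)
    then obtain c b where c: "coprime c (int p)" and b: "of_int c * ev f th ^ Suc j * \<alpha> = ev b th" by blast
    define \<beta> where "\<beta> = of_int c * ev f th ^ j * \<alpha>"
    have fb: "ev f th * \<beta> = ev b th" using b by (simp add: \<beta>_def mult_ac)
    have "algebraic_int \<beta>"
      unfolding \<beta>_def by (intro algebraic_int_mult algebraic_int_power algebraic_int_ev th_algebraic_int \<alpha>) auto
    then obtain P where P: "lead_coeff P = 1" "ev P \<beta> = 0" using algebraic_int_iff_ev by auto
    define m where "m = degree P"
    \<comment> \<open>The monic equation of \<open>\<beta>\<close> is multiplied by
      \<open>f(\<theta>)^m\<close>. As \<open>f(\<theta>) \<beta> = b(\<theta>)\<close>, each lower
      term keeps a factor \<open>f(\<theta>)\<close>, so \<open>b\<close> is nilpotent modulo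
      \<open>(f, p)\<close>.\<close>
    have "ev b th ^ m = ev f th ^ m * \<beta> ^ m" unfolding fb[symmetric] by (rule power_mult_distrib)
    also have "\<dots> = (\<Sum>i<m. ev f th ^ m * (of_int (- coeff P i) * \<beta> ^ i))"
      unfolding m_def monic_root_power_eq[OF P] sum_distrib_left ..
    also have "\<dots> = (\<Sum>i<m. ev f th * (of_int (- coeff P i) * ev f th ^ (m - Suc i) * ev b th ^ i))"
    proof (rule sum.cong)
      fix i assume "i \<in> {..<m}"
      then have "ev f th ^ m = ev f th * ev f th ^ (m - Suc i) * ev f th ^ i"
        by (simp add: power_add[symmetric] power_Suc[symmetric] del: power_Suc)
      then show "ev f th ^ m * (of_int (- coeff P i) * \<beta> ^ i) =
          ev f th * (of_int (- coeff P i) * ev f th ^ (m - Suc i) * ev b th ^ i)"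
        unfolding fb[symmetric] power_mult_distrib by (simp only: mult_ac)
    qed simp
    finally have "ev (b ^ m - f * (\<Sum>i<m. smult (- coeff P i) (f ^ (m - Suc i) * b ^ i))) th = 0"
      by (simp add: sum_distrib_left mult_ac)
    then obtain v where "b ^ m - f * (\<Sum>i<m. smult (- coeff P i) (f ^ (m - Suc i) * b ^ i)) = Phi * v"
      using int_min_poly by blast
    then have bm: "b ^ m = f * (\<Sum>i<m. smult (- coeff P i) (f ^ (m - Suc i) * b ^ i)) + Phi * v"
      by (simp add: algebra_simps)
    have "pcong f p (f * u) 0" for u unfolding pcong_def by (intro exI[of _ u] exI[of _ 0]) simp
    then have "pcong f p (b ^ m) (0 + 0 * v)"
      unfolding bm by (intro pcong_add pcong_mult Phi pcong_refl) auto
    then have "pcong f p b 0" using pcong_reduced[OF p fix_x] by simp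
    then obtain u' v' where "b = f * u' + of_nat p * v'" unfolding pcong_def by auto
    then have "ev f th * \<beta> = ev f th * ev u' th + of_nat p * ev v' th"
      using fb ev_of_int[of "int p"] by simp
    \<comment> \<open>The factor \<open>s\<close> turns \<open>p\<close> into
      \<open>p s = f(\<theta>) q(\<theta>)\<close>, after which \<open>f(\<theta>)\<close>
      cancels.\<close>
    then have "of_int s * (ev f th * \<beta>) = of_int s * (ev f th * ev u' th + of_nat p * ev v' th)" by simp
    then have "ev f th * (of_int s * \<beta>) = ev f th * (of_int s * ev u' th) + of_int (int p * s) * ev v' th"
      unfolding distrib_left by (simp only: mult_ac of_int_mult of_int_of_nat_eq)
    also have "\<dots> = ev f th * ev (smult s u' + q * v') th"
      unfolding q[symmetric] by (simp add: algebra_simps)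
    finally have "of_int s * \<beta> = ev (smult s u' + q * v') th"
      by (rule mult_left_cancel[OF f0, THEN iffD1])
    moreover have "of_int (s * c) * ev f th ^ j * \<alpha> = of_int s * \<beta>"
      by (simp only: \<beta>_def of_int_mult mult.assoc)
    ultimately have "of_int (s * c) * ev f th ^ j * \<alpha> = ev (smult s u' + q * v') th" by metis
    moreover have "coprime (s * c) (int p)" using s c by simp
    ultimately show ?case by blast
  qed
  from this[of 0] obtain c u where c: "coprime c (int p)" and u: "of_int c * \<alpha> = ev u th" by auto
  \<comment> \<open>Both \<open>c \<alpha>\<close> and \<open>p \<alpha>\<close> lie in
    \<open>\<int>[\<theta>]\<close>, and \<open>c\<close> and \<open>p\<close> are coprime.\<close>
  obtain y z where yz: "y * c + z * int p = 1"
    using c bezout_int[of c "int p"] by (auto simp: coprime_iff_gcd_eq_1)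
  have "\<alpha> = of_int (y * c + z * int p) * \<alpha>" unfolding yz by simp
  also have "\<dots> = of_int y * (of_int c * \<alpha>) + of_int z * (of_nat p * \<alpha>)" by (simp add: algebra_simps)
  also have "\<dots> = ev (smult y u + smult z a) th" using p0 unfolding u by (simp add: \<alpha>_def)
  finally have "ev a th = of_nat p * ev (smult y u + smult z a) th"
    using p0 by (simp add: \<alpha>_def field_simps)
  then show "\<exists>b. ev a th = of_nat p * ev b th" by blast
qed

end

context monic_irreducible_disc begin

text \<open>Cramer's rule for \<open>V\<close>: a coordinate times \<open>det V\<close> is a
  determinant whose entries are powers of the roots and conjugates of \<open>z\<close>, hence an
  algebraic integer. The fourth power turns \<open>det V\<close> into \<open>d\<close>.\<close>

lemma coeff_co_power4_int:
  assumes z: "z \<in> OK" and i: "i < N"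
  shows "of_int d * coeff (co z) i ^ 4 \<in> \<int>"
proof -
  define v where "v = vec N (\<lambda>i. of_rat (coeff (co z) i) :: complex)"
  define A where "A = replace_col V (V *\<^sub>v v) i"
  have Vv: "V *\<^sub>v v = vec N (\<lambda>k. sg k z)"
    by (rule eq_vecI) (simp_all add: V_def v_def scalar_prod_def atLeast0LessThan sg_eq_sum[OF OK_K[OF z]] mult.commute)
  have A_eq: "A = mat N N (\<lambda>(k, j). if j = i then sg k z else x k ^ j)"
    unfolding A_def Vv by (rule eq_matI) (auto simp: replace_col_def V_def)
  have "algebraic_int (x k)" if "k < N" for k
    using ev_Phi_x[OF that] monic algebraic_int_iff_ev by blast
  then have "algebraic_int (det A)"
    by (intro algebraic_int_det[of _ N])
      (auto simp: A_eq intro!: algebraic_int_power algebraic_int_sg z)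
  moreover have "det A = of_rat (coeff (co z) i) * det V"
    unfolding A_def using cramer_lemma_mat[OF V_carrier, of v i] i by (simp add: v_def)
  ultimately have "algebraic_int ((of_rat (coeff (co z) i) * det V) ^ 4)" by (metis algebraic_int_power)
  also have "(of_rat (coeff (co z) i) * det V) ^ 4 = D\<^sup>2 * of_rat (coeff (co z) i) ^ 4"
    by (simp add: D_eq power_mult_distrib)
  also have "\<dots> = of_rat (of_int d * coeff (co z) i ^ 4)"
    by (simp add: D_sq of_rat_mult of_rat_power)
  finally have "algebraic_int (of_rat (of_int d * coeff (co z) i ^ 4) :: complex)" .
  then have "(of_rat (of_int d * coeff (co z) i ^ 4) :: complex) \<in> \<int>"
    by (rule rational_algebraic_int_is_int) simp
  then obtain k where "(of_rat (of_int d * coeff (co z) i ^ 4) :: complex) = of_rat (of_int k)"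
    by (auto elim: Ints_cases)
  then show ?thesis unfolding of_rat_eq_iff by simp
qed

text \<open>For each coefficient \<open>b\<^sub>i\<close> of the numerator reduced modulo
  \<open>Phi\<close>, \<open>p ^ 4\<close> divides \<open>d * b\<^sub>i ^ 4\<close> by
  \<open>coeff_co_power4_int\<close>.\<close>

lemma maximal_at_if_not_dvd_disc:
  assumes p: "prime p" and pd: "\<not> int p dvd d"
  shows "maximal_at th p"
  unfolding maximal_at_def
proof (intro allI impI)
  fix a assume ai: "algebraic_int (ev a th / of_nat p)"
  have p0: "p > 1" using p prime_gt_1_nat by blast
  obtain q b where qb: "a = Phi * q + b" "degree b < N" using int_division by blast
  then have ab: "ev a th = ev b th" using root by simp
  define z where "z = ev a th / of_nat p"
  have z': "z = of_rat (1 / of_nat p) * ev b th" by (simp add: z_def ab of_rat_divide)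
  have "z \<in> K" unfolding z' by (intro K_mult) auto
  then have z: "z \<in> OK" using ai by (intro OK_I) (auto simp: z_def)
  have co: "co z = smult (1 / of_nat p) (map_poly of_int b)"
    unfolding z' by (simp add: co_scale co_ev[OF qb(2)])
  have "int p dvd coeff b i" for i
  proof (cases "i < N")
    case True
    obtain k where "of_int d * coeff (co z) i ^ 4 = of_int k"
      using coeff_co_power4_int[OF z True] by (auto elim: Ints_cases)
    then have "of_int d * (of_int (coeff b i) / rat_of_nat p) ^ 4 = of_int k" by (simp add: co)
    then have "of_int (d * coeff b i ^ 4) = rat_of_int (k * int p ^ 4)"
      using p0 by (simp add: power_divide field_simps)
    then have "d * coeff b i ^ 4 = k * int p ^ 4" unfolding of_int_eq_iff .
    then have "int p dvd d * coeff b i ^ 4" by simp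
    then have "int p dvd coeff b i ^ 4" using p pd by (simp add: prime_dvd_mult_iff)
    then show ?thesis using p by (simp add: prime_dvd_power_iff)
  next
    case False
    then show ?thesis using qb(2) by (simp add: coeff_eq_0)
  qed
  then have "[:int p:] dvd b" by (simp add: const_poly_dvd_iff)
  then obtain c where "b = smult (int p) c" by (auto elim!: dvdE)
  then have "ev a th = of_nat p * ev c th" by (simp add: ab)
  then show "\<exists>b. ev a th = of_nat p * ev b th" by blast
qed

end

section \<open>Chebyshev polynomials\<close>

abbreviation X :: "int poly" where "X \<equiv> [:0, 1:]"

text \<open>The second kind with shifted index, \<open>U\<^sub>d\<^sub>-\<^sub>1(x/2)\<close>: its
  value at \<open>z + 1/z\<close> is \<open>(z^d - z^-d) / (z - 1/z)\<close>.\<close>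

fun chebyshev_S :: "nat \<Rightarrow> int poly" where
  "chebyshev_S 0 = 0"
| "chebyshev_S (Suc 0) = 1"
| "chebyshev_S (Suc (Suc d)) = X * chebyshev_S (Suc d) - chebyshev_S d"

text \<open>At \<open>z + 1/z\<close> this is \<open>(z^(2m+1) - 1) / (z^m (z - 1))\<close>, so the
  roots are \<open>\<zeta> + 1/\<zeta>\<close> with \<open>\<zeta>^(2m+1) = 1\<close> and
  \<open>\<zeta> \<noteq> 1\<close>.\<close>

definition chebyshev_G :: "nat \<Rightarrow> int poly" where
  "chebyshev_G m = chebyshev_S (Suc m) + chebyshev_S m"

text \<open>At \<open>z + 1/z\<close> this is \<open>(z^(2m+1) + 1) / (z^m (z + 1))\<close>, with
  roots from \<open>\<zeta>^(2m+1) = -1\<close> and \<open>\<zeta> \<noteq> -1\<close>.\<close>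

definition chebyshev_H :: "nat \<Rightarrow> int poly" where
  "chebyshev_H m = chebyshev_S (Suc m) - chebyshev_S m"

lemma chebyshev_S_degree_monic:
  "degree (chebyshev_S (Suc d)) = d \<and> lead_coeff (chebyshev_S (Suc d)) = 1 \<and> degree (chebyshev_S d) \<le> d - 1"
proof (induction d)
  case (Suc d)
  let ?p = "X * chebyshev_S (Suc d)" and ?q = "chebyshev_S d"
  have ne: "chebyshev_S (Suc d) \<noteq> 0" using Suc by auto
  have dp: "degree ?p = Suc d" using Suc ne by (subst degree_mult_eq) auto
  have IH: "degree (chebyshev_S (Suc d)) = d" "lead_coeff (chebyshev_S (Suc d)) = 1" using Suc by auto
  then have lp: "coeff ?p (Suc d) = 1" by simp
  have dq: "degree ?q < Suc d" using Suc by auto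
  have "degree (chebyshev_S (Suc (Suc d))) = Suc d"
    unfolding chebyshev_S.simps diff_conv_add_uminus using dp dq by (subst degree_add_eq_left) auto
  moreover have "coeff (chebyshev_S (Suc (Suc d))) (Suc d) = 1"
    unfolding chebyshev_S.simps coeff_diff using lp coeff_eq_0[OF dq] by simp
  ultimately show ?case using Suc by simp
qed auto

lemma chebyshev_G_degree_monic:
  "degree (chebyshev_G m) = m" "lead_coeff (chebyshev_G m) = 1"
  and chebyshev_H_degree_monic: "degree (chebyshev_H m) = m" "lead_coeff (chebyshev_H m) = 1"
proof -
  have "degree (chebyshev_G m) = m \<and> lead_coeff (chebyshev_G m) = 1 \<and>
    degree (chebyshev_H m) = m \<and> lead_coeff (chebyshev_H m) = 1"
  proof (cases m)
    case 0
    then show ?thesis by (simp add: chebyshev_G_def chebyshev_H_def)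
  next
    case (Suc k)
    have d: "degree (chebyshev_S m) < degree (chebyshev_S (Suc m))" "degree (chebyshev_S (Suc m)) = m"
      "coeff (chebyshev_S (Suc m)) m = 1" "coeff (chebyshev_S m) m = 0"
      using chebyshev_S_degree_monic[of m] Suc by (auto intro: coeff_eq_0)
    have "degree (chebyshev_G m) = m" unfolding chebyshev_G_def using d by (subst degree_add_eq_left) auto
    moreover have "degree (chebyshev_H m) = m"
      unfolding chebyshev_H_def diff_conv_add_uminus using d by (subst degree_add_eq_left) auto
    ultimately show ?thesis using d by (simp add: chebyshev_G_def chebyshev_H_def)
  qed
  then show "degree (chebyshev_G m) = m" "lead_coeff (chebyshev_G m) = 1"
    "degree (chebyshev_H m) = m" "lead_coeff (chebyshev_H m) = 1" by auto
qed

lemma ev_chebyshev_T: "z \<noteq> 0 \<Longrightarrow> ev (chebyshev_T d) (z + inverse z) = z ^ d + inverse z ^ d"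
  unfolding ev_def by (rule chebyshev_T_identity)

lemma ev_chebyshev_S:
  "z \<noteq> 0 \<Longrightarrow> ev (chebyshev_S d) (z + inverse z) * (z - inverse z) = z ^ d - inverse z ^ d"
proof (induction d rule: chebyshev_S.induct)
  case (3 d)
  have "ev (chebyshev_S (Suc (Suc d))) (z + inverse z) * (z - inverse z) =
    (z + inverse z) * (z ^ Suc d - inverse z ^ Suc d) - (z ^ d - inverse z ^ d)"
    unfolding 3(1)[OF 3(3), symmetric] 3(2)[OF 3(3), symmetric] by (simp add: algebra_simps)
  also have "\<dots> = z ^ Suc (Suc d) - inverse z ^ Suc (Suc d)"
  proof -
    have "(z + w) * (z * A - w * B) - (A - B) = z * (z * A) - w * (w * B) + (z * w - 1) * (A - B)" for w A B
      by (simp add: algebra_simps)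
    from this[of "inverse z" "z ^ d" "inverse z ^ d"] show ?thesis using 3(3) by simp
  qed
  finally show ?case .
qed auto

text \<open>Every complex number has the form \<open>z + 1/z\<close>. Excluding
  \<open>z = 1/z\<close> loses only the values \<open>2\<close> and \<open>-2\<close> and permits
  division by \<open>z - 1/z\<close>.\<close>

lemma ev_eq_imp_eq:
  assumes "\<And>z. z \<noteq> 0 \<Longrightarrow> z \<noteq> inverse z \<Longrightarrow> ev p (z + inverse z) = ev q (z + inverse z)"
  shows "p = q"
proof -
  define r :: "complex poly" where "r = map_poly of_int p - map_poly of_int q"
  have "- {2, -2} \<subseteq> {w. poly r w = 0}"
  proof safe
    fix w :: complex assume w: "w \<noteq> -2" "w \<noteq> 2"
    obtain z where z: "z \<noteq> 0" "w = z + inverse z" using complex_eq_plus_inverse by blast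
    have "z \<noteq> inverse z"
    proof
      assume e: "z = inverse z"
      then have "z * z = 1" using z(1) by (metis right_inverse)
      then have "z = 1 \<or> z = -1" by (metis square_eq_1_iff)
      then show False using w z by auto
    qed
    then show "poly r w = 0" using assms[OF z(1)] z by (simp add: r_def ev_def)
  qed
  moreover have "infinite (- {2, -2 :: complex})"
    using infinite_UNIV_char_0[where 'a=complex] by (simp add: finite_compl)
  ultimately have "infinite {w. poly r w = 0}" using finite_subset by blast
  then have "r = 0" using poly_roots_finite by blast
  then show ?thesis by (simp add: r_def)
qed

text \<open>With \<open>c = 2m + 1\<close> the two left sides are
  \<open>(z^c - 1) (z^a - z^-(a+c))\<close> and \<open>(z^c + 1) (z^a + z^-(a+c))\<close> at
  \<open>z + 1/z\<close>. The case \<open>a = 0\<close> gives the square factors of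
  \<open>T - 2\<close> and \<open>T + 2\<close>; general \<open>a\<close> gives period
  \<open>c\<close> modulo \<open>(X - 2) G\<close> and a change of sign after \<open>c\<close> steps
  modulo \<open>(X + 2) H\<close>.\<close>

lemma chebyshev_T_add_odd:
  shows chebyshev_T_diff_eq: "chebyshev_T (a + (2 * m + 1)) - chebyshev_T a =
      [:-2, 1:] * chebyshev_G m * chebyshev_G (a + m)" (is "?l1 = ?r1")
    and chebyshev_T_sum_eq: "chebyshev_T (a + (2 * m + 1)) + chebyshev_T a =
      [:2, 1:] * chebyshev_H m * chebyshev_H (a + m)" (is "?l2 = ?r2")
proof -
  have "ev ?l1 (z + inverse z) = ev ?r1 (z + inverse z) \<and> ev ?l2 (z + inverse z) = ev ?r2 (z + inverse z)"
    if z: "z \<noteq> 0" "z \<noteq> inverse z" for z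
  proof -
    define u v where "u = z" and "v = inverse z"
    define A B C E where "A = u ^ m" and "B = v ^ m" and "C = u ^ a" and "E = v ^ a"
    have uv: "u * v = 1" using z by (simp add: u_def v_def)
    have AB: "A * B = 1" "C * E = 1" unfolding A_def B_def C_def E_def power_mult_distrib[symmetric] uv by auto
    have d: "u - v \<noteq> 0" using z by (simp add: u_def v_def)
    note S = ev_chebyshev_S[OF z(1), folded u_def v_def]
    have G: "ev (chebyshev_G k) (u + v) * (u - v) = (u + 1) * (u ^ k - v ^ Suc k)" for k
    proof -
      have "v ^ k = u * v ^ Suc k" using uv by (simp add: mult.assoc[symmetric])
      then show ?thesis unfolding chebyshev_G_def ev_add distrib_right S by (simp add: algebra_simps)
    qed
    have H: "ev (chebyshev_H k) (u + v) * (u - v) = (u - 1) * (u ^ k + v ^ Suc k)" for k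
    proof -
      have "v ^ k = u * v ^ Suc k" using uv by (simp add: mult.assoc[symmetric])
      then show ?thesis unfolding chebyshev_H_def ev_diff left_diff_distrib S by (simp add: algebra_simps)
    qed
    have T: "ev (chebyshev_T k) (u + v) = u ^ k + v ^ k" for k
      unfolding u_def v_def by (rule ev_chebyshev_T[OF z(1)])
    have e: "a + (2 * m + 1) = a + m + m + 1" by simp
    have pw: "u ^ (a + (2 * m + 1)) = C * A * A * u" "v ^ (a + (2 * m + 1)) = E * B * B * v"
      "u ^ (a + m) = C * A" "v ^ Suc (a + m) = E * B * v" "v ^ Suc m = B * v" "u ^ m = A" "u ^ a = C" "v ^ a = E"
      unfolding e A_def B_def C_def E_def by (simp_all add: power_add)
    \<comment> \<open>Multiplying by \<open>(u - v)\<^sup>2\<close> makes the values of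
      \<open>G\<close> and \<open>H\<close> explicit; \<open>s = 1\<close> serves the difference and
      \<open>s = -1\<close> the sum.\<close>
    have comb: "(u - v) * (u - v) * L = W * ((u + s) * P) * ((u + s) * Q)"
      if "v * L = P * Q" "W = v * ((u - s) * (u - s))" "s * s = 1" for L P Q W s
    proof -
      have "u - v = v * ((u - s) * (u + s))" using uv that(3) by (simp add: algebra_simps)
      then have "(u - v) * (u - v) * L = v * ((u - s) * (u - s)) * (u + s) * (u + s) * (v * L)"
        by (simp only: mult_ac)
      then show ?thesis unfolding that(1,2) by (simp only: mult_ac)
    qed
    have "(u - v) * (u - v) * ev ?l1 (u + v) = (u + v - 2) * ((u + 1) * (A - B * v)) * ((u + 1) * (C * A - E * B * v))"
    proof -
      have "v * (C * A * A * u + E * B * B * v - (C + E)) = (A - B * v) * (C * A - E * B * v)"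
      proof -
        have "v * (C * A * A * u + E * B * B * v - (C + E)) =
            (A - B * v) * (C * A - E * B * v) + (u * v - 1) * (C * A * A) + (A * B - 1) * (C * v + E * v)"
          by (simp add: algebra_simps)
        then show ?thesis using uv AB by simp
      qed
      moreover have "u + v - 2 = v * ((u - 1) * (u - 1))" using uv by (simp add: algebra_simps)
      ultimately show ?thesis unfolding ev_diff T pw by (intro comb) simp_all
    qed
    also have "\<dots> = (u - v) * (u - v) * ev ?r1 (u + v)"
    proof -
      have "ev [:-2, 1:] (u + v) = u + v - 2" by simp
      then show ?thesis
        unfolding ev_mult G[of m, unfolded pw, symmetric] G[of "a + m", unfolded pw, symmetric] by (simp only: mult_ac)
    qed
    finally have 1: "ev ?l1 (u + v) = ev ?r1 (u + v)" using d by simp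
    have "(u - v) * (u - v) * ev ?l2 (u + v) = (u + v + 2) * ((u - 1) * (A + B * v)) * ((u - 1) * (C * A + E * B * v))"
    proof -
      have "v * (C * A * A * u + E * B * B * v + (C + E)) = (A + B * v) * (C * A + E * B * v)"
      proof -
        have "v * (C * A * A * u + E * B * B * v + (C + E)) =
            (A + B * v) * (C * A + E * B * v) + (u * v - 1) * (C * A * A) - (A * B - 1) * (C * v + E * v)"
          by (simp add: algebra_simps)
        then show ?thesis using uv AB by simp
      qed
      moreover have "u + v + 2 = v * ((u + 1) * (u + 1))" using uv by (simp add: algebra_simps)
      ultimately show ?thesis unfolding ev_add T pw using comb[of _ _ _ _ "-1"] by simp
    qed
    also have "\<dots> = (u - v) * (u - v) * ev ?r2 (u + v)"
    proof -
      have "ev [:2, 1:] (u + v) = u + v + 2" by simp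
      then show ?thesis
        unfolding ev_mult H[of m, unfolded pw, symmetric] H[of "a + m", unfolded pw, symmetric] by (simp only: mult_ac)
    qed
    finally have "ev ?l2 (u + v) = ev ?r2 (u + v)" using d by simp
    with 1 show ?thesis by (simp add: u_def v_def)
  qed
  then show "?l1 = ?r1" "?l2 = ?r2" by (blast intro: ev_eq_imp_eq)+
qed

text \<open>A Pell equation: \<open>(a + b)\<^sup>2 - 4 a b = (a - b)\<^sup>2\<close> with
  \<open>a = z^d\<close> and \<open>b = z^-d\<close>. It evaluates the derivative of
  \<open>Phi\<close> at the roots.\<close>

lemma chebyshev_T_square: "(chebyshev_T d)\<^sup>2 - 4 = [:-4, 0, 1:] * (chebyshev_S d)\<^sup>2"
proof (rule ev_eq_imp_eq)
  fix z :: complex assume z: "z \<noteq> 0" "z \<noteq> inverse z"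
  define u v where "u = z" and "v = inverse z"
  have uv: "u * v = 1" using z by (simp add: u_def v_def)
  have sq: "(a + b)\<^sup>2 - 4 * (a * b) = (a - b)\<^sup>2" for a b :: complex
    by (simp add: power2_eq_square algebra_simps)
  have uvd: "u ^ d * v ^ d = 1" unfolding power_mult_distrib[symmetric] uv by simp
  have "ev ([:-4, 0, 1:] * (chebyshev_S d)\<^sup>2) (u + v) = ((u + v)\<^sup>2 - 4) * (ev (chebyshev_S d) (u + v))\<^sup>2"
    by (simp add: power2_eq_square algebra_simps)
  also have "(u + v)\<^sup>2 - 4 = (u - v)\<^sup>2" using sq[of u v] uv by simp
  also have "(u - v)\<^sup>2 * (ev (chebyshev_S d) (u + v))\<^sup>2 = (u ^ d - v ^ d)\<^sup>2"
    using ev_chebyshev_S[OF z(1), of d] by (metis mult.commute power_mult_distrib u_def v_def)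
  also have "\<dots> = (u ^ d + v ^ d)\<^sup>2 - 4" using sq[of "u ^ d" "v ^ d"] uvd by simp
  also have "\<dots> = ev ((chebyshev_T d)\<^sup>2 - 4) (u + v)"
    using ev_chebyshev_T[OF z(1), of d] ev_of_int[of 4] by (simp add: u_def v_def)
  finally show "ev ((chebyshev_T d)\<^sup>2 - 4) (z + inverse z) = ev ([:-4, 0, 1:] * (chebyshev_S d)\<^sup>2) (z + inverse z)"
    by (simp only: u_def v_def)
qed

lemma chebyshev_T_compose: "pcompose (chebyshev_T a) (chebyshev_T b) = chebyshev_T (a * b)"
proof (rule ev_eq_imp_eq)
  fix z :: complex assume z: "z \<noteq> 0"
  then show "ev (pcompose (chebyshev_T a) (chebyshev_T b)) (z + inverse z) = ev (chebyshev_T (a * b)) (z + inverse z)"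
    using ev_chebyshev_T[of "z ^ b" a]
    by (simp add: ev_chebyshev_T power_inverse power_mult[symmetric] mult.commute)
qed

lemma chebyshev_T_iter_eq: "chebyshev_T_iter l n = chebyshev_T (l ^ n)"
  unfolding chebyshev_T_iter_def by (induction n) (simp_all add: chebyshev_T_compose)

lemma chebyshev_T_eq_S: "chebyshev_T (Suc d) = chebyshev_S (Suc (Suc d)) - chebyshev_S d"
proof (induction d rule: chebyshev_S.induct)
  case 2
  show ?case by (simp add: one_pCons)
next
  case (3 d)
  have "chebyshev_T (Suc (Suc (Suc d))) = X * (chebyshev_S (Suc (Suc (Suc d))) - chebyshev_S (Suc d)) -
      (chebyshev_S (Suc (Suc d)) - chebyshev_S d)"
    unfolding 3[symmetric] by (rule chebyshev_T.simps)
  also have "\<dots> = (X * chebyshev_S (Suc (Suc (Suc d))) - chebyshev_S (Suc (Suc d))) -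
      (X * chebyshev_S (Suc d) - chebyshev_S d)"
    by (simp only: right_diff_distrib diff_diff_eq2 diff_diff_eq add_ac diff_add_eq)
  finally show ?case unfolding chebyshev_S.simps(3)[symmetric] .
qed simp

lemma pderiv_chebyshev_T: "pderiv (chebyshev_T d) = smult (int d) (chebyshev_S d)"
proof (induction d rule: chebyshev_T.induct)
  case (3 d)
  have "pderiv (chebyshev_T (Suc (Suc d))) =
      chebyshev_T (Suc d) + X * pderiv (chebyshev_T (Suc d)) - pderiv (chebyshev_T d)"
    by (simp add: pderiv_diff pderiv_mult pderiv_pCons)
  also have "\<dots> = (chebyshev_S (Suc (Suc d)) - chebyshev_S d) + smult (int (Suc d)) (X * chebyshev_S (Suc d)) -
      smult (int d) (chebyshev_S d)"
    unfolding 3 mult_smult_right unfolding chebyshev_T_eq_S ..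
  also have "\<dots> = (chebyshev_S (Suc (Suc d)) - chebyshev_S d) +
      smult (int (Suc d)) (chebyshev_S (Suc (Suc d)) + chebyshev_S d) - smult (int d) (chebyshev_S d)"
  proof -
    have "X * chebyshev_S (Suc d) = chebyshev_S (Suc (Suc d)) + chebyshev_S d" by simp
    then show ?thesis by (simp only:)
  qed
  also have "\<dots> = smult (int (Suc (Suc d))) (chebyshev_S (Suc (Suc d)))"
    by (rule poly_eqI) (simp add: algebra_simps del: chebyshev_S.simps)
  finally show ?case .
qed (simp_all add: pderiv_pCons)

lemma chebyshev_T_at_2: "poly (chebyshev_T d) 2 = 2"
  by (induction d rule: chebyshev_T.induct) simp_all

lemma chebyshev_T_at_minus_2: "poly (chebyshev_T d) (- 2) = 2 * (- 1) ^ d"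
  by (induction d rule: chebyshev_T.induct) simp_all

lemma chebyshev_T_at_0: "odd d \<Longrightarrow> poly (chebyshev_T d) 0 = 0"
  by (induction d rule: chebyshev_T.induct) simp_all

text \<open>As the derivative of \<open>T\<close> is \<open>p S\<close>, \<open>p\<close> divides
  \<open>i\<close> times the \<open>i\<close>-th coefficient, hence the coefficient itself for
  \<open>0 < i < p\<close>. The constant term is \<open>0\<close> for odd \<open>p\<close> and
  \<open>-2\<close> for \<open>p = 2\<close>.\<close>

lemma chebyshev_T_prime_cong:
  assumes p: "prime p"
  shows "pcong 0 p (chebyshev_T p) (monom 1 p)"
proof -
  have p0: "p > 0" using p prime_gt_0_nat by blast
  have deg: "degree (chebyshev_T p) = p" "lead_coeff (chebyshev_T p) = 1"
    using chebyshev_T_degree_monic[OF p0] by auto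
  have "int p dvd coeff (chebyshev_T p - monom 1 p) i" for i
  proof -
    consider "i = 0" | "0 < i" "i < p" | "i = p" | "i > p" by linarith
    then show ?thesis
    proof cases
      case 1
      have "int p dvd coeff (chebyshev_T p) 0"
      proof (cases "odd p")
        case True
        then show ?thesis using chebyshev_T_at_0[of p] by (simp add: poly_0_coeff_0)
      next
        case False
        then have "p = 2" using p prime_odd_nat prime_ge_2_nat by (metis le_neq_implies_less)
        then show ?thesis by (simp add: numeral_2_eq_2)
      qed
      then show ?thesis using 1 p0 by simp
    next
      case 2
      have "int i * coeff (chebyshev_T p) i = int p * coeff (chebyshev_S p) (i - 1)"
        using arg_cong[OF pderiv_chebyshev_T[of p], of "\<lambda>q. coeff q (i - 1)"] 2 by (simp add: coeff_pderiv)
      then have "int p dvd int i * coeff (chebyshev_T p) i" by simp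
      moreover have "\<not> int p dvd int i" using 2 by (auto dest: nat_dvd_not_less)
      ultimately show ?thesis using p 2 by (simp add: prime_dvd_mult_iff)
    next
      case 3
      then show ?thesis using deg by simp
    next
      case 4
      then show ?thesis using deg by (simp add: coeff_eq_0)
    qed
  qed
  then have "[:int p:] dvd chebyshev_T p - monom 1 p" by (simp add: const_poly_dvd_iff)
  then show ?thesis unfolding pcong_def by (auto elim!: dvdE simp: of_nat_poly)
qed

lemma chebyshev_T_prime_power_cong:
  assumes p: "prime p"
  shows "pcong 0 p (chebyshev_T (p ^ k)) (monom 1 (p ^ k))"
proof (induction k)
  case 0
  have "chebyshev_T 1 = monom 1 1" by (simp add: monom_altdef)
  then show ?case by simp
next
  case (Suc k)
  have "pcong 0 p (pcompose (chebyshev_T p) (chebyshev_T (p ^ k))) (pcompose (monom 1 p) (chebyshev_T (p ^ k)))"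
    by (rule pcong_pcompose_left[OF chebyshev_T_prime_cong[OF p]])
  moreover have "pcompose (monom 1 p) (chebyshev_T (p ^ k)) = chebyshev_T (p ^ k) ^ p"
    by (simp add: monom_altdef pcompose_hom.hom_power pcompose_pCons)
  moreover have "pcong 0 p (chebyshev_T (p ^ k) ^ p) (monom 1 (p ^ k) ^ p)" by (rule pcong_power[OF Suc])
  moreover have "monom 1 (p ^ k) ^ p = (monom 1 (p ^ Suc k) :: int poly)"
    by (simp add: monom_altdef power_mult[symmetric] mult.commute)
  ultimately show ?case unfolding chebyshev_T_compose by (metis pcong_trans power_Suc)
qed

text \<open>The roots of \<open>f\<close> are of the form \<open>\<zeta> + \<zeta>\<^sup>-\<^sup>1\<close> with \<open>\<zeta>\<^sup>c = 1\<close>, so that they are fixed by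
  \<open>T\<^sub>q\<close> whenever \<open>q \<equiv> 1\<close> modulo \<open>c\<close>, and \<open>T\<^sub>q \<equiv> X\<^sup>q\<close> for a power \<open>q\<close> of \<open>p\<close>.\<close>

lemma fixed_by_frobenius_power:
  assumes p: "prime p" "coprime p c" and period: "\<And>a. f dvd chebyshev_T (a + c) - chebyshev_T a"
  obtains k where "k > 0" "pcong f p (monom 1 (p ^ k)) X"
proof -
  have dvd: "f dvd chebyshev_T (1 + j * c) - X" for j
  proof (induction j)
    case (Suc j)
    have "f dvd (chebyshev_T (1 + j * c + c) - chebyshev_T (1 + j * c)) + (chebyshev_T (1 + j * c) - X)"
      by (intro dvd_add period Suc)
    then show ?case by (simp add: algebra_simps)
  qed simp
  have "c > 0"
  proof (rule ccontr)
    assume "\<not> c > 0"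
    then show False using p by (auto simp: prime_nat_iff)
  qed
  then have tot: "totient c > 0" by simp
  \<comment> \<open>Euler's theorem supplies a power of \<open>p\<close> that is \<open>1\<close>
    modulo the period.\<close>
  have "[p ^ totient c = 1] (mod c)" using p by (intro euler_theorem) simp
  moreover have "1 \<le> p ^ totient c" using prime_gt_0_nat[OF p(1)] by simp
  ultimately obtain j where j: "p ^ totient c = 1 + j * c"
    using cong_le_nat[of 1 "p ^ totient c" c] by auto
  have "pcong f p (monom 1 (p ^ totient c)) (chebyshev_T (p ^ totient c))"
    by (rule pcong_weaken[OF pcong_sym[OF chebyshev_T_prime_power_cong[OF p(1)]]])
  moreover have "pcong f p (chebyshev_T (p ^ totient c)) X"
  proof -
    obtain u where "chebyshev_T (1 + j * c) - X = f * u" using dvd[of j] by blast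
    then have "chebyshev_T (1 + j * c) - X = f * u + of_nat p * 0" by simp
    then show ?thesis unfolding pcong_def j by blast
  qed
  ultimately show thesis using that[OF tot] pcong_trans by blast
qed

lemma chebyshev_G_fixed:
  assumes "prime p" "coprime p (2 * m + 1)"
  obtains k where "k > 0" "pcong ([:-2, 1:] * chebyshev_G m) p (monom 1 (p ^ k)) X"
proof (rule fixed_by_frobenius_power[OF assms])
  fix a
  show "[:-2, 1:] * chebyshev_G m dvd chebyshev_T (a + (2 * m + 1)) - chebyshev_T a"
    unfolding chebyshev_T_diff_eq by (rule dvd_triv_left)
qed (rule that)

lemma add_diff_add_cancel: "P - R = (P + Q) - (Q + R)" for P Q R :: "'a :: ab_group_add"
  by simp

text \<open>Modulo \<open>(X + 2) H\<close> the sequence \<open>T\<close> changes sign after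
  \<open>2m + 1\<close> steps, so its period is \<open>2 (2m + 1)\<close>, to which \<open>p\<close>
  must be prime.\<close>

lemma chebyshev_H_fixed:
  assumes "prime p" "odd p" "coprime p (2 * m + 1)"
  obtains k where "k > 0" "pcong ([:2, 1:] * chebyshev_H m) p (monom 1 (p ^ k)) X"
proof (rule fixed_by_frobenius_power[OF assms(1)])
  show "coprime p (2 * (2 * m + 1))" using assms by (simp del: mult_Suc_right)
  fix a
  define c where "c = 2 * m + 1"
  have "chebyshev_T ((a + c) + c) - chebyshev_T a = (chebyshev_T ((a + c) + c) + chebyshev_T (a + c)) -
      (chebyshev_T (a + c) + chebyshev_T a)"
    by (rule add_diff_add_cancel)
  also have "[:2, 1:] * chebyshev_H m dvd \<dots>"
    unfolding c_def chebyshev_T_sum_eq by (intro dvd_diff dvd_triv_left)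
  finally show "[:2, 1:] * chebyshev_H m dvd chebyshev_T (a + 2 * (2 * m + 1)) - chebyshev_T a"
    unfolding c_def mult_2 add.assoc .
qed (rule that)

section \<open>The squared discriminant, and local criteria for
  \<open>\<Phi> = (X + c) g\<^sup>2 - e\<close>\<close>

lemma poly_pderiv_prod_linear:
  fixes x :: "nat \<Rightarrow> 'a :: idom"
  assumes "finite A" "k \<in> A"
  shows "poly (pderiv (\<Prod>i\<in>A. [:- x i, 1:])) (x k) = (\<Prod>i\<in>A - {k}. x k - x i)"
proof -
  have "(\<Prod>i\<in>A. [:- x i, 1:]) = [:- x k, 1:] * (\<Prod>i\<in>A - {k}. [:- x i, 1:])"
    using assms by (rule prod.remove)
  then show ?thesis
    by (simp only: pderiv_mult poly_add poly_mult) (simp add: pderiv_pCons poly_prod)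
qed

lemma prod_pairs_symmetric:
  fixes g :: "nat \<Rightarrow> nat \<Rightarrow> 'a :: comm_monoid_mult"
  assumes "\<And>i j. g i j = g j i"
  shows "(\<Prod>k<n. \<Prod>i\<in>{..<n} - {k}. g k i) = (\<Prod>j<n. \<Prod>i<j. g j i * g j i)"
proof -
  have "(\<Prod>k<n. \<Prod>i\<in>{..<n} - {k}. g k i) = (\<Prod>k<n. (\<Prod>i<k. g k i) * (\<Prod>i\<in>{k<..<n}. g k i))"
  proof (rule prod.cong)
    fix k assume "k \<in> {..<n}"
    then have split: "{..<n} - {k} = {..<k} \<union> {k<..<n}" by auto
    show "(\<Prod>i\<in>{..<n} - {k}. g k i) = (\<Prod>i<k. g k i) * (\<Prod>i\<in>{k<..<n}. g k i)"
      unfolding split by (rule prod.union_disjoint) auto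
  qed simp
  also have "\<dots> = (\<Prod>k<n. \<Prod>i<k. g k i) * (\<Prod>k<n. \<Prod>i\<in>{k<..<n}. g k i)"
    by (rule prod.distrib)
  also have "(\<Prod>k<n. \<Prod>i\<in>{k<..<n}. g k i) = (\<Prod>(k, i)\<in>(SIGMA k:{..<n}. {k<..<n}). g k i)"
    by (rule prod.Sigma) auto
  also have "\<dots> = (\<Prod>(j, i)\<in>(SIGMA j:{..<n}. {..<j}). g j i)"
    by (rule prod.reindex_bij_witness[of _ "\<lambda>(j, i). (i, j)" "\<lambda>(i, j). (j, i)"]) (auto intro: assms)
  also have "\<dots> = (\<Prod>j<n. \<Prod>i<j. g j i)"
    by (rule prod.Sigma[symmetric]) auto
  finally show ?thesis by (simp add: prod.distrib)
qed

lemma squarefree_cofactor_coprime: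
  assumes p: "prime p" and sf: "squarefree e" and e: "e = int p * s"
  shows "coprime s (int p)"
proof -
  have "\<not> int p dvd s"
  proof
    assume "int p dvd s"
    then have "int p ^ 2 dvd e" unfolding e power2_eq_square by (rule mult_dvd_mono[OF dvd_refl])
    then have "int p dvd 1" using sf unfolding squarefree_def by blast
    then show False using p by auto
  qed
  then have "coprime (int p) s" using p by (intro prime_imp_coprime) auto
  then show ?thesis by (simp add: coprime_commute)
qed

lemma ev_linear: "ev [:c, 1:] z = of_int c + z"
  by simp

context monic_irreducible begin

lemma ev_Phi_prod: "ev Phi y = (\<Prod>k<N. y - x k)"
  by (simp add: ev_def Phi_factor poly_prod)

text \<open>\<open>Phi'(x k)\<close> is the product of the differences \<open>x k - x i\<close>;
  squaring makes these symmetric in \<open>i\<close> and \<open>k\<close>, so pairs can be collected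
  without a sign.\<close>

lemma D_square: "D\<^sup>2 = (\<Prod>k<N. (ev (pderiv Phi) (x k))\<^sup>2)"
proof -
  have "ev (pderiv Phi) (x k) = (\<Prod>i\<in>{..<N} - {k}. x k - x i)" if "k < N" for k
    using poly_pderiv_prod_linear[of "{..<N}" k x] that
    by (simp add: ev_def of_int_hom.map_poly_pderiv Phi_factor)
  then have "(\<Prod>k<N. (ev (pderiv Phi) (x k))\<^sup>2) = (\<Prod>k<N. \<Prod>i\<in>{..<N} - {k}. (x k - x i)\<^sup>2)"
    by (simp add: prod_power_distrib)
  also have "\<dots> = (\<Prod>j<N. \<Prod>i<j. (x j - x i)\<^sup>2 * (x j - x i)\<^sup>2)"
    by (rule prod_pairs_symmetric) (rule power2_commute)
  also have "\<dots> = (det V) ^ 4"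
    unfolding V_def det_vandermonde[OF inj_x] power_add[symmetric] by (simp add: prod_power_distrib)
  finally show ?thesis by (simp add: D_eq)
qed

text \<open>Coordinates in the power basis are unique, so for a quotient in
  \<open>\<int>[\<theta>]\<close> the integer \<open>y\<close> would divide the leading coefficient
  \<open>1\<close> of \<open>q\<close>.\<close>

lemma not_maximal:
  assumes q: "lead_coeff q = 1" "degree q < N" and y: "\<bar>y\<bar> > 1"
    and ai: "algebraic_int (ev q th / of_int y)"
  shows "\<not> OK \<subseteq> range (\<lambda>b. ev b th)"
proof
  assume sub: "OK \<subseteq> range (\<lambda>b. ev b th)"
  have "ev q th / of_int y = of_rat (1 / of_int y) * ev q th" by (simp add: of_rat_divide)
  then have "ev q th / of_int y \<in> K" by (auto intro: K_mult)
  then obtain b where b: "ev q th / of_int y = ev b th" using sub OK_I[OF _ ai] by auto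
  obtain u r where ur: "b = Phi * u + r" "degree r < N" using int_division by blast
  have "ev q th = of_int y * ev r th" using b y root by (simp add: ur field_simps)
  then have "rv (map_poly of_int (q - smult y r)) th = 0" by simp
  moreover have "degree (q - smult y r) < N"
    using q(2) ur(2) le_less_trans[OF degree_smult_le] by (intro degree_diff_less) auto
  ultimately have "map_poly of_int (q - smult y r) = (0 :: rat poly)"
    by (intro rat_poly_eq_0) auto
  then have "q = smult y r" by simp
  then have "y dvd lead_coeff q" by simp
  then show False using q(1) y by auto
qed

text \<open>\<open>[:c, 1:] * g\<close> plays the role of the uniformizer.\<close>

lemma maximal_at_square_factor:
  assumes p: "prime p" and Phi: "Phi = [:c, 1:] * g * g - [:e:]" and e: "e = int p * s" "coprime s (int p)"
    and fix_x: "pcong ([:c, 1:] * g) p (monom 1 (p ^ k)) X" "k > 0"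
  shows "maximal_at th p"
proof (rule maximal_at_if_uniformizer[OF p fix_x _ _ e(2)])
  have gg: "(of_int c + th) * ev g th * ev g th = of_int e"
    using root unfolding Phi by (simp add: algebra_simps)
  have "Phi - 0 = [:c, 1:] * g * g + of_nat p * [:- s:]"
    unfolding Phi e(1) by (simp add: of_nat_poly)
  then show "pcong ([:c, 1:] * g) p Phi 0" unfolding pcong_def by blast
  show "ev ([:c, 1:] * g) th * ev g th = of_int (int p * s)"
    unfolding ev_mult ev_linear gg e(1) ..
  \<comment> \<open>Exponent \<open>2\<close> suffices as the power divisible by \<open>p\<close>:
    the square is \<open>(\<theta> + c) e\<close>.\<close>
  have "ev ([:c, 1:] * g) th ^ 2 = (of_int c + th) * ((of_int c + th) * ev g th * ev g th)"
    unfolding ev_mult ev_linear power2_eq_square by (simp only: mult_ac)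
  also have "\<dots> = of_nat p * ev (smult s [:c, 1:]) th"
    unfolding gg e(1) ev_smult ev_linear of_int_mult of_int_of_nat_eq by (simp only: mult_ac)
  finally show "ev ([:c, 1:] * g) th ^ 2 = of_nat p * ev (smult s [:c, 1:]) th" .
qed

text \<open>The square of \<open>(\<theta> + c) g(\<theta>) / y\<close> is
  \<open>(\<theta> + c) e / y\<^sup>2\<close>, an element of
  \<open>\<int>[\<theta>]\<close>.\<close>

lemma not_maximal_square_factor:
  assumes Phi: "Phi = [:c, 1:] * g * g - [:e:]" and g: "lead_coeff g = 1" "Suc (degree g) < N"
    and y: "y\<^sup>2 dvd e" "\<bar>y\<bar> > 1"
  shows "\<not> OK \<subseteq> range (\<lambda>b. ev b th)"
proof (rule not_maximal[of "[:c, 1:] * g" y])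
  have g0: "g \<noteq> 0" using g by auto
  show "degree ([:c, 1:] * g) < N" using g g0 by (subst degree_mult_eq) auto
  show "lead_coeff ([:c, 1:] * g) = 1" using g lead_coeff_mult[of "[:c, 1:]" g] by simp
  show "\<bar>y\<bar> > 1" by fact
  obtain s where s: "e = y\<^sup>2 * s" using y by blast
  have gg: "(of_int c + th) * ev g th * ev g th = of_int e"
    using root unfolding Phi by (simp add: algebra_simps)
  have "(ev ([:c, 1:] * g) th / of_int y)\<^sup>2 = (of_int c + th) * ((of_int c + th) * ev g th * ev g th) / (of_int y)\<^sup>2"
    unfolding power_divide unfolding ev_mult ev_linear power2_eq_square by (simp only: mult_ac)
  also have "\<dots> = ev 0 th * (ev ([:c, 1:] * g) th / of_int y) + ev (smult s [:c, 1:]) th"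
  proof -
    have "(of_int y)\<^sup>2 \<noteq> (0 :: complex)" using y(2) by auto
    then show ?thesis unfolding gg s ev_smult ev_linear ev_0 by (simp add: mult.commute)
  qed
  finally show "algebraic_int (ev ([:c, 1:] * g) th / of_int y)"
    by (rule algebraic_int_quadratic[OF th_algebraic_int])
qed

end

section \<open>Roots of Chebyshev polynomials\<close>

locale chebyshev_field =
  fixes l n :: nat and t :: int and th :: complex
  assumes l: "prime l" "odd l" and n: "n > 0"
    and irreducible: "irreducible (map_poly of_int (chebyshev_T (l ^ n) - [:t:]) :: rat poly)"
    and is_root: "ev (chebyshev_T (l ^ n) - [:t:]) th = 0"
begin

abbreviation Phi where "Phi \<equiv> chebyshev_T (l ^ n) - [:t:]"

definition m where "m = l ^ n div 2"

lemma l_gt_1: "l > 1"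
  using l prime_gt_1_nat by blast

lemma ln_eq: "l ^ n = 2 * m + 1"
  using l unfolding m_def by (metis even_power odd_two_times_div_two_succ)

lemma m_pos: "m > 0"
proof (rule ccontr)
  assume "\<not> m > 0"
  then show False using ln_eq l_gt_1 n by simp
qed

lemma degree_Phi: "degree Phi = l ^ n" and lead_coeff_Phi: "lead_coeff Phi = 1"
proof -
  have T: "degree (chebyshev_T (l ^ n)) = l ^ n" "lead_coeff (chebyshev_T (l ^ n)) = 1"
    using chebyshev_T_degree_monic[of "l ^ n"] ln_eq by auto
  show d: "degree Phi = l ^ n"
    unfolding diff_conv_add_uminus using T ln_eq by (subst degree_add_eq_left) auto
  show "lead_coeff Phi = 1" unfolding d using T ln_eq by (simp add: coeff_pCons)
qed

sublocale monic_irreducible Phi th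
  by unfold_locales (use lead_coeff_Phi irreducible is_root in auto)

lemma N_eq: "N = l ^ n"
  by (simp add: N_def degree_Phi)

lemma N_eq_odd: "N = 2 * m + 1"
  by (rule trans[OF N_eq ln_eq])

lemma Phi_eq_G: "Phi = [:-2, 1:] * chebyshev_G m * chebyshev_G m - [:t - 2:]"
proof -
  have "P = Q - [:t - 2:]" if "P + [:t:] - [:2:] = Q" for P Q
    unfolding that[symmetric] by simp
  moreover have "Phi + [:t:] - [:2:] = [:-2, 1:] * chebyshev_G m * chebyshev_G m"
    using chebyshev_T_diff_eq[of 0 m] unfolding ln_eq by simp
  ultimately show ?thesis .
qed

lemma Phi_eq_H: "Phi = [:2, 1:] * chebyshev_H m * chebyshev_H m - [:t + 2:]"
proof -
  have "P = Q - [:t + 2:]" if "P + [:t:] + [:2:] = Q" for P Q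
    unfolding that[symmetric] by simp
  moreover have "Phi + [:t:] + [:2:] = [:2, 1:] * chebyshev_H m * chebyshev_H m"
    using chebyshev_T_sum_eq[of 0 m] unfolding ln_eq by simp
  ultimately show ?thesis .
qed

text \<open>For \<open>e = 0\<close> the element \<open>th\<close> would be a root of
  \<open>X + c\<close> or of \<open>g\<close>, both nonzero of degree below
  \<open>N\<close>.\<close>

lemma square_factor_constant_neq_0:
  assumes Phi: "Phi = [:c, 1:] * g * g - [:e:]" and g: "degree g = m" "lead_coeff g = 1"
  shows "e \<noteq> 0"
proof
  assume "e = 0"
  then have "ev ([:c, 1:] * g * g) th = 0" using is_root unfolding Phi by simp
  then have "ev [:c, 1:] th * ev g th * ev g th = 0" unfolding ev_mult .
  then consider "ev [:c, 1:] th = 0" | "ev g th = 0" unfolding mult_eq_0_iff by blast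
  then show False
  proof cases
    case 1
    then have "map_poly of_int [:c, 1:] = (0 :: rat poly)"
      using m_pos by (intro rat_poly_eq_0) (auto simp: N_eq_odd)
    then show False by simp
  next
    case 2
    then have "map_poly of_int g = (0 :: rat poly)"
      using g by (intro rat_poly_eq_0) (auto simp: N_eq_odd)
    then show False using g by auto
  qed
qed

lemma t_neq: "t - 2 \<noteq> 0" "t + 2 \<noteq> 0"
  using square_factor_constant_neq_0[OF Phi_eq_G] square_factor_constant_neq_0[OF Phi_eq_H]
    chebyshev_G_degree_monic chebyshev_H_degree_monic by auto

definition disc where "disc = int (l ^ n) ^ (2 * l ^ n) * ((t - 2) * (t + 2)) ^ (l ^ n - 1)"

text \<open>By the Pell equation, \<open>\<Phi>'(x k)\<^sup>2 (x k\<^sup>2 - 4) = N\<^sup>2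
  (t\<^sup>2 - 4)\<close> at each root. In the product over \<open>k\<close>, the factors
  \<open>x k\<^sup>2 - 4\<close> contribute \<open>\<Phi>(2) \<Phi>(-2) = t\<^sup>2 - 4\<close>,
  which cancels one power.\<close>

lemma D_square_eq: "D\<^sup>2 = of_int disc"
proof -
  define e where "e = (t - 2) * (t + 2)"
  have e: "e \<noteq> 0" using t_neq by (simp add: e_def)
  have "(ev (pderiv Phi) (x k))\<^sup>2 * ((2 - x k) * (- 2 - x k)) = of_int (int N ^ 2 * e)" if k: "k < N" for k
  proof -
    have T: "ev (chebyshev_T N) (x k) = of_int t" using ev_Phi_x[OF k] by (simp add: N_eq)
    have "pderiv Phi = smult (int N) (chebyshev_S N)" by (simp add: pderiv_diff pderiv_chebyshev_T N_eq pderiv_pCons)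
    then have "(ev (pderiv Phi) (x k))\<^sup>2 * ((2 - x k) * (- 2 - x k)) =
        of_nat N ^ 2 * ev ([:-4, 0, 1:] * (chebyshev_S N)\<^sup>2) (x k)"
      by (simp add: power2_eq_square algebra_simps)
    also have "\<dots> = of_nat N ^ 2 * ((of_int t)\<^sup>2 - 4)"
      unfolding chebyshev_T_square[symmetric] using T ev_of_int[of 4] by simp
    also have "(of_int t)\<^sup>2 - 4 = (of_int e :: complex)" by (simp add: e_def power2_eq_square algebra_simps)
    finally show ?thesis by simp
  qed
  then have "(\<Prod>k<N. (ev (pderiv Phi) (x k))\<^sup>2 * ((2 - x k) * (- 2 - x k))) = of_int (int N ^ 2 * e) ^ N"
    by simp
  then have "D\<^sup>2 * ((\<Prod>k<N. 2 - x k) * (\<Prod>k<N. - 2 - x k)) = of_int (int N ^ 2 * e) ^ N"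
    by (simp add: D_square prod.distrib)
  moreover have "(\<Prod>k<N. 2 - x k) * (\<Prod>k<N. - 2 - x k) = of_int e"
  proof -
    have "ev p (of_int k) = of_int (poly p k)" for p k by (simp add: ev_def)
    from this[of Phi 2] this[of Phi "-2"]
    have "ev Phi 2 * ev Phi (- 2) = of_int (poly Phi 2 * poly Phi (- 2))" by simp
    also have "poly Phi 2 * poly Phi (- 2) = e"
      using l(2) by (simp add: chebyshev_T_at_2 chebyshev_T_at_minus_2 e_def algebra_simps)
    finally show ?thesis unfolding ev_Phi_prod .
  qed
  ultimately have "D\<^sup>2 * of_int e = of_int (int N ^ 2 * e) ^ N" by simp
  also have "\<dots> = of_int disc * of_int e"
  proof -
    define q where "q = l ^ n"
    have "q > 0" unfolding q_def ln_eq by simp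
    have "(int q ^ 2 * e) ^ q = int q ^ (2 * q) * e ^ (q - 1) * e"
      unfolding mult.assoc power_minus_mult[OF \<open>q > 0\<close>] power_mult_distrib power_mult by (rule refl)
    then have "(int N ^ 2 * e) ^ N = disc * e"
      unfolding N_eq disc_def q_def e_def[symmetric] .
    then show ?thesis unfolding of_int_power[symmetric] of_int_mult[symmetric] by (rule arg_cong)
  qed
  finally show ?thesis using e by simp
qed

sublocale monic_irreducible_disc Phi th disc
  by unfold_locales (rule D_square_eq)

section \<open>The primes other than \<open>l\<close> dividing \<open>t - 2\<close> or
  \<open>t + 2\<close>\<close>

lemma maximal_at_factor_G:
  assumes p: "prime p" "p \<noteq> l" "int p dvd t - 2" and sf: "squarefree (t - 2)"
  shows "maximal_at th p"
proof -
  obtain s where s: "t - 2 = int p * s" using p by blast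
  have "coprime p (2 * m + 1)"
    unfolding ln_eq[symmetric] using p l by (simp add: primes_coprime)
  then obtain k where "k > 0" "pcong ([:-2, 1:] * chebyshev_G m) p (monom 1 (p ^ k)) X"
    using chebyshev_G_fixed[OF p(1)] by blast
  then show ?thesis
    using maximal_at_square_factor[OF p(1) Phi_eq_G s] squarefree_cofactor_coprime[OF p(1) sf s] by blast
qed

lemma maximal_at_factor_H:
  assumes p: "prime p" "p \<noteq> l" "odd p" "int p dvd t + 2" and sf: "squarefree (t + 2)"
  shows "maximal_at th p"
proof -
  obtain s where s: "t + 2 = int p * s" using p by blast
  have "coprime p (2 * m + 1)"
    unfolding ln_eq[symmetric] using p l by (simp add: primes_coprime)
  then obtain k where "k > 0" "pcong ([:2, 1:] * chebyshev_H m) p (monom 1 (p ^ k)) X"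
    using chebyshev_H_fixed[OF p(1,3)] by blast
  then show ?thesis
    using maximal_at_square_factor[OF p(1) Phi_eq_H s] squarefree_cofactor_coprime[OF p(1) sf s] by blast
qed

section \<open>The prime \<open>l\<close>\<close>

lemma Phi_cong_power:
  obtains v where "[:- t, 1:] ^ (l ^ n) - Phi = of_nat l * v"
proof -
  \<comment> \<open>Frobenius turns \<open>(X - t)^N\<close> into \<open>X^N - t\<close> modulo
    \<open>l\<close>, and \<open>X^N\<close> is congruent to \<open>T\<^sub>N\<close>.\<close>
  have "pcong 0 l ([:- t, 1:] ^ (l ^ n)) (pcompose [:- t, 1:] (monom 1 (l ^ n)))"
    by (rule pcong_frobenius_power[OF l(1)])
  also have "pcompose [:- t, 1:] (monom 1 (l ^ n)) = monom 1 (l ^ n) + [:- t:]"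
    by (simp add: pcompose_pCons)
  finally have "pcong 0 l ([:- t, 1:] ^ (l ^ n)) (monom 1 (l ^ n) + [:- t:])" .
  moreover have "pcong 0 l (monom 1 (l ^ n) + [:- t:]) (chebyshev_T (l ^ n) + [:- t:])"
    by (intro pcong_add pcong_refl pcong_sym[OF chebyshev_T_prime_power_cong] l(1))
  ultimately have "pcong 0 l ([:- t, 1:] ^ (l ^ n)) (chebyshev_T (l ^ n) + [:- t:])" by (rule pcong_trans)
  moreover have "chebyshev_T (l ^ n) + [:- t:] = Phi" by simp
  ultimately have "pcong 0 l ([:- t, 1:] ^ (l ^ n)) Phi" by (simp only:)
  then show thesis unfolding pcong_def mult_zero_left add_0 using that by blast
qed

definition quot where "quot = synthetic_div Phi t"

lemma Phi_eq_quot: "Phi = [:- t, 1:] * quot + [:poly Phi t:]"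
  unfolding quot_def by (rule synthetic_div_correct'[symmetric])

lemma quot_root: "ev [:- t, 1:] th * ev quot th = - of_int (poly Phi t)"
proof -
  define c where "c = poly Phi t"
  have "ev ([:- t, 1:] * quot + [:c:]) th = 0" unfolding c_def Phi_eq_quot[symmetric] by (rule is_root)
  moreover have "ev [:c:] th = of_int c" by simp
  ultimately show ?thesis unfolding ev_add ev_mult c_def[symmetric] by (simp only: add_eq_0_iff2)
qed

lemma l_dvd_Phi_t: "int l dvd poly Phi t"
proof -
  obtain v where v: "[:- t, 1:] ^ (l ^ n) - Phi = of_nat l * v" by (rule Phi_cong_power)
  have "poly ([:- t, 1:] ^ (l ^ n) - Phi) t = - poly Phi t"
    using ln_eq by (simp add: poly_power)
  then have "- poly Phi t = int l * poly v t" unfolding v by (simp add: of_nat_poly)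
  then show ?thesis by (metis dvd_minus_iff dvd_triv_left)
qed

text \<open>For \<open>f = X - t\<close> the quotient by \<open>(f, l)\<close> is the prime field,
  so Fermat gives \<open>k = 1\<close>. The power of \<open>f(\<theta>)\<close> divisible by
  \<open>l\<close> comes from \<open>Phi_cong_power\<close>, and the cofactor is \<open>-s\<close>
  because \<open>(\<theta> - t) q(\<theta>) = -\<Phi>(t)\<close>.\<close>

lemma maximal_at_l:
  assumes "\<not> (int l)\<^sup>2 dvd poly Phi t"
  shows "maximal_at th l"
proof -
  obtain s where s: "poly Phi t = int l * s" using l_dvd_Phi_t by blast
  have "\<not> int l dvd s" using assms unfolding s power2_eq_square by (metis dvd_refl mult_dvd_mono)
  then have "coprime (int l) s" using l by (intro prime_imp_coprime) auto
  then have cop: "coprime (- s) (int l)" by (simp add: coprime_commute)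
  obtain c where c: "t ^ l - t = int l * c" using prime_dvd_power_diff_self[OF l(1)] by blast
  define u where "u = synthetic_div (monom 1 l) t"
  have "monom 1 l = [:- t, 1:] * u + [:t ^ l:]"
    unfolding u_def using synthetic_div_correct'[of t "monom 1 l"] by (simp add: poly_monom)
  moreover have "X = [:- t, 1:] * 1 + [:t:]" by simp
  ultimately have "monom 1 l - X = [:- t, 1:] * u - [:- t, 1:] * 1 + ([:t ^ l:] - [:t:])"
    by (metis add_diff_add)
  also have "[:t ^ l:] - [:t:] = of_nat l * [:c:]" using c by (simp add: of_nat_poly)
  finally have "monom 1 (l ^ 1) - X = [:- t, 1:] * (u - 1) + of_nat l * [:c:]"
    by (simp only: right_diff_distrib power_one_right)
  then have fix_x: "pcong [:- t, 1:] l (monom 1 (l ^ 1)) X" unfolding pcong_def by blast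
  have "Phi - 0 = [:- t, 1:] * quot + of_nat l * [:s:]"
    using Phi_eq_quot unfolding s by (simp add: of_nat_poly)
  then have Phi0: "pcong [:- t, 1:] l Phi 0" unfolding pcong_def by blast
  obtain v where v: "[:- t, 1:] ^ (l ^ n) - Phi = of_nat l * v" by (rule Phi_cong_power)
  have "ev [:- t, 1:] th ^ (l ^ n) = ev ([:- t, 1:] ^ (l ^ n) - Phi) th"
    using is_root by (simp del: ev_diff add: ev_diff[of _ Phi])
  also have "\<dots> = of_nat l * ev v th" unfolding v using ev_of_int[of "int l"] by simp
  finally have w: "ev [:- t, 1:] th ^ (l ^ n) = of_nat l * ev v th" .
  have "ev [:- t, 1:] th * ev quot th = of_int (int l * - s)" unfolding quot_root s by simp
  from maximal_at_if_uniformizer[OF l(1) fix_x _ Phi0 this cop w] show ?thesis by simp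
qed

text \<open>Modulo \<open>l\<close>, \<open>quot\<close> is congruent to
  \<open>(X - t)^(N-1)\<close>. With \<open>F = \<theta> - t\<close>, \<open>Q = q(\<theta>)\<close>
  and \<open>Q = F^(N-1) + l R\<close>, multiplying by \<open>Q\<close> and using
  \<open>F Q = -l\<^sup>2 c\<close> gives \<open>Y\<^sup>2 = R Y - c F^(N-2)\<close> for
  \<open>Y = Q / l\<close>.\<close>

lemma not_maximal_at_l:
  assumes "(int l)\<^sup>2 dvd poly Phi t"
  shows "\<not> OK \<subseteq> range (\<lambda>b. ev b th)"
proof (rule not_maximal[of quot "int l"])
  \<comment> \<open>\<open>N - 2\<close> is the power of \<open>F\<close> left after one of the
    \<open>N - 1\<close> factors is paired with \<open>Q\<close>.\<close>
  define M where "M = l ^ n - 2"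
  have M: "l ^ n = Suc (Suc M)" using ln_eq m_pos by (simp add: M_def)
  have q0: "quot \<noteq> 0"
  proof
    assume "quot = 0"
    then have "degree Phi = 0" using Phi_eq_quot by (metis add_0 degree_pCons_0 mult_zero_right)
    then show False using degree_Phi M by simp
  qed
  have deg: "degree quot = Suc M"
    unfolding quot_def degree_synthetic_div degree_Phi unfolding M by simp
  have "coeff ([:- t, 1:] * quot + [:poly Phi t:]) (Suc (Suc M)) = 1"
    using lead_coeff_Phi Phi_eq_quot degree_Phi M by metis
  then show "lead_coeff quot = 1" using deg by (simp add: coeff_eq_0)
  show "degree quot < N" using deg N_eq M by simp
  show "\<bar>int l\<bar> > 1" using l_gt_1 by simp
  obtain c where c: "poly Phi t = (int l)\<^sup>2 * c" using assms by blast
  obtain v where v: "[:- t, 1:] ^ (l ^ n) - Phi = of_nat l * v" by (rule Phi_cong_power)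
  have "[:- t, 1:] * (quot - [:- t, 1:] ^ Suc M) = ([:- t, 1:] * quot + [:poly Phi t:]) -
      [:- t, 1:] ^ (l ^ n) - [:poly Phi t:]"
    unfolding M by (simp add: right_diff_distrib)
  also have "\<dots> = - (of_nat l * v) - [:poly Phi t:]"
    unfolding Phi_eq_quot[symmetric] v[symmetric] by simp
  also have "\<dots> = [:int l:] * (- v - [:int l * c:])"
    unfolding c by (simp add: of_nat_poly power2_eq_square smult_diff_right)
  finally have "[:int l:] dvd [:- t, 1:] * (quot - [:- t, 1:] ^ Suc M)" by (metis dvd_triv_left)
  \<comment> \<open>The constant \<open>l\<close> is prime in \<open>\<int>[X]\<close> and does not
    divide the monic \<open>X - t\<close>, which therefore cancels modulo \<open>l\<close>.\<close>
  moreover have "prime_elem [:int l:]" using l by (simp add: prime_elem_const_poly_iff)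
  moreover have "\<not> [:int l:] dvd [:- t, 1:]"
    using l_gt_1 by (auto simp: const_poly_dvd_iff coeff_pCons split: nat.splits dest: spec[of _ 1])
  ultimately have "[:int l:] dvd quot - [:- t, 1:] ^ Suc M" by (metis prime_elem_dvd_mult_iff)
  then obtain r where "quot - [:- t, 1:] ^ Suc M = smult (int l) r" by (auto elim!: dvdE)
  then have q: "quot = [:- t, 1:] ^ Suc M + smult (int l) r" by (simp add: algebra_simps)
  define F Q R where "F = ev [:- t, 1:] th" and "Q = ev quot th" and "R = ev r th"
  have QR: "Q = F * F ^ M + of_nat l * R" unfolding Q_def F_def R_def
    by (subst q) (simp only: ev_add ev_mult ev_power power_Suc ev_smult of_int_of_nat_eq)
  have FQ: "F * Q = - ((of_nat l)\<^sup>2 * of_int c)" using quot_root unfolding F_def Q_def c by simp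
  have "Q\<^sup>2 = Q * (F * F ^ M + of_nat l * R)" unfolding power2_eq_square by (subst (2) QR) (rule refl)
  also have "\<dots> = (F * Q) * F ^ M + of_nat l * R * Q" by (simp add: algebra_simps)
  finally have "(Q / of_nat l)\<^sup>2 = (- ((of_nat l)\<^sup>2 * of_int c) * F ^ M + of_nat l * R * Q) / (of_nat l)\<^sup>2"
    unfolding FQ by (simp add: power_divide)
  also have "\<dots> = R * (Q / of_nat l) + of_int (- c) * F ^ M"
    using l_gt_1 by (simp add: field_simps power2_eq_square)
  also have "\<dots> = ev r th * (Q / of_nat l) + ev (smult (- c) ([:- t, 1:] ^ M)) th"
    by (simp add: R_def F_def)
  finally have "algebraic_int (Q / of_nat l)" by (rule algebraic_int_quadratic[OF th_algebraic_int])
  then show "algebraic_int (ev quot th / of_int (int l))" by (simp add: Q_def)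
qed

theorem discriminant_eq_iff:
  "D = field_discriminant K \<longleftrightarrow>
    \<not> [poly Phi t = 0] (mod (int l)\<^sup>2) \<and> squarefree (t - 2) \<and> squarefree (t + 2)"
  unfolding field_discriminant_iff cong_0_iff
proof (intro iffI conjI)
  assume sub: "OK \<subseteq> range (\<lambda>b. ev b th)"
  show "\<not> (int l)\<^sup>2 dvd poly Phi t" using not_maximal_at_l sub by blast
  have *: "squarefree e" if Phi: "Phi = [:c, 1:] * g * g - [:e:]" and g: "degree g = m" "lead_coeff g = 1" for c e g
  proof (rule ccontr)
    assume "\<not> squarefree e"
    then obtain y where y: "y\<^sup>2 dvd e" "\<not> y dvd 1" unfolding squarefree_def by blast
    have "y \<noteq> 0" using y(1) square_factor_constant_neq_0[OF Phi g] by auto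
    then have "\<bar>y\<bar> > 1" using y(2) by (cases "\<bar>y\<bar> = 1") auto
    moreover have "Suc (degree g) < N" unfolding N_eq_odd g(1) using m_pos by simp
    ultimately show False using not_maximal_square_factor[OF Phi g(2) _ y(1)] sub by blast
  qed
  show "squarefree (t - 2)" by (rule *[OF Phi_eq_G chebyshev_G_degree_monic])
  show "squarefree (t + 2)" by (rule *[OF Phi_eq_H chebyshev_H_degree_monic])
next
  assume *: "\<not> (int l)\<^sup>2 dvd poly Phi t \<and> squarefree (t - 2) \<and> squarefree (t + 2)"
  show "OK \<subseteq> range (\<lambda>b. ev b th)"
  proof (rule OK_subset_if_maximal)
    fix p :: nat assume p: "prime p"
    show "maximal_at th p"
    proof (cases "p = l \<or> \<not> int p dvd disc")
      case True
      then show ?thesis using maximal_at_l * maximal_at_if_not_dvd_disc[OF p] by blast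
    next
      case False
      have "prime (int p)" using p by simp
      moreover have "\<not> int p dvd int (l ^ n) ^ (2 * l ^ n)"
        using False p l by (metis of_nat_dvd_iff prime_dvd_power primes_dvd_imp_eq of_nat_power)
      ultimately have "int p dvd (t - 2) * (t + 2)"
        using False unfolding disc_def by (metis prime_dvd_mult_iff prime_dvd_power)
      then have pt: "int p dvd t - 2 \<or> int p dvd t + 2" using \<open>prime (int p)\<close> by (simp add: prime_dvd_mult_iff)
      show ?thesis
      proof (cases "int p dvd t - 2")
        case True
        then show ?thesis using maximal_at_factor_G p False * by blast
      next
        case nd: False
        \<comment> \<open>The prime \<open>2\<close> divides \<open>t + 2\<close> only together with
          \<open>t - 2\<close>, so it belongs to the case of the factor \<open>G\<close>.\<close>
        have "odd p"
        proof
          assume "even p"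
          then have "p = 2" using p by (metis le_neq_implies_less prime_ge_2_nat prime_odd_nat)
          then show False using pt nd by simp
        qed
        then show ?thesis using maximal_at_factor_H p False * pt nd by blast
      qed
    qed
  qed
qed

end

theorem theorem3p3:
  fixes l n :: nat and t :: int and \<Phi> :: "int poly" and \<theta> :: complex
  assumes "prime l" and "odd l" and "n > 0"
    and "\<Phi> = chebyshev_T_iter l n - [:t:]"
    and "irreducible (map_poly of_int \<Phi> :: rat poly)"
    and "poly (map_poly of_int \<Phi>) \<theta> = 0"
  shows "poly_discriminant (map_poly of_int \<Phi>) = field_discriminant (rat_adjoin \<theta>) \<longleftrightarrow>
    \<not> [poly \<Phi> t = 0] (mod (int l)\<^sup>2) \<and> squarefree (t - 2) \<and> squarefree (t + 2)"
proof -
  have \<Phi>: "\<Phi> = chebyshev_T (l ^ n) - [:t:]" using assms(4) by (simp add: chebyshev_T_iter_eq)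
  interpret chebyshev_field l n t \<theta>
    by unfold_locales (use assms in \<open>simp_all add: \<Phi> ev_def\<close>)
  show ?thesis using discriminant_eq_iff unfolding D_def K_def \<Phi> .
qed

end
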